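(* Let $n\ge2$, let $L$ be an infinitely smooth origin-symmetric convex body in $\mathbb R^n$ with positive curvature, and let $f_{n-1},g\in C^2(\mathbb R^n\setminus\{0\})$ be even functions such that $f_{n-1}$ is strictly positive on $\mathbb R^n\setminus\{0\}$. For $\varepsilon>0$ define a star-shaped body $D$ by the following equation for its radial function $\|x\|_D^{-1}$: $$\int_0^{\|x\|_D^{-1}}t^{n-2}f_{n-1}(tx)\,dt=\int_0^{\|x\|_L^{-1}}t^{n-2}f_{n-1}(tx)\,dt-\varepsilon g(x),\qquad\forall x\in S^{n-1}.$$ Then, if $\varepsilon$ is small enough, the body $D$ is convex.
   Context: For a body $K$ star-shaped with respect to the origin, $\|x\|_K=\min\{a>0:x\in aK\}$ (for $x\neq 0$) is its Minkowski functional, and $\|x\|_K^{-1}$, $x\in S^{n-1}$, is its radial function. A convex body is a compact convex set with non-empty interior. "Infinitely smooth with positive curvature" means that the boundary is a $C^\infty$ hypersurface with everywhere positive Gaussian curvature. The integrals $\int_0^R t^{n-2}f_{n-1}(tx)\,dt$, $x\in S^{n-1}$, $R>0$, are assumed finite (standing local integrability of $f_{n-1}$). *)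

theory Defs
  imports "HOL-Analysis.Analysis"
begin

text \<open>\<open>Ck_on k f S\<close> is meant for open \<open>S\<close>: all partial derivatives of order at most \<open>k\<close>
  exist and are continuous on \<open>S\<close>. Values of \<open>f\<close> outside \<open>S\<close> are irrelevant.\<close>

primrec Ck_on :: "nat \<Rightarrow> ('a::euclidean_space \<Rightarrow> real) \<Rightarrow> 'a set \<Rightarrow> bool" where
  "Ck_on 0 f S \<longleftrightarrow> continuous_on S f"
| "Ck_on (Suc k) f S \<longleftrightarrow>
     (\<forall>x\<in>S. f differentiable (at x)) \<and>
     (\<forall>b\<in>Basis. Ck_on k (\<lambda>x. frechet_derivative f (at x) b) S)"

definition even_off_origin :: "('a::real_vector \<Rightarrow> real) \<Rightarrow> bool" where
  "even_off_origin f \<longleftrightarrow> (\<forall>x. x \<noteq> 0 \<longrightarrow> f (- x) = f x)"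

definition convex_body :: "'a::euclidean_space set \<Rightarrow> bool" where
  "convex_body K \<longleftrightarrow> compact K \<and> convex K \<and> interior K \<noteq> {}"

definition origin_symmetric :: "'a::real_vector set \<Rightarrow> bool" where
  "origin_symmetric K \<longleftrightarrow> (\<forall>x\<in>K. - x \<in> K)"

text \<open>The origin has to be an interior point for the minimum defining the Minkowski functional
  to exist in every direction.\<close>

definition star_body :: "'a::euclidean_space set \<Rightarrow> bool" where
  "star_body K \<longleftrightarrow> compact K \<and> 0 \<in> interior K \<and> (\<forall>x\<in>K. closed_segment 0 x \<subseteq> K)"

text \<open>Only meaningful for \<open>x \<noteq> 0\<close>: at the origin the minimum does not exist.\<close>

definition minkowski_functional :: "'a::euclidean_space set \<Rightarrow> 'a \<Rightarrow> real" where
  "minkowski_functional K x = (LEAST a. 0 < a \<and> x \<in> (\<lambda>y. a *\<^sub>R y) ` K)"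

definition radial_function :: "'a::euclidean_space set \<Rightarrow> 'a \<Rightarrow> real" where
  "radial_function K x = inverse (minkowski_functional K x)"

definition smooth_hypersurface :: "'a::euclidean_space set \<Rightarrow> bool" where
  "smooth_hypersurface M \<longleftrightarrow>
     (\<forall>p\<in>M. \<exists>U \<phi>. open U \<and> p \<in> U \<and> (\<forall>k. Ck_on k \<phi> U) \<and>
        (\<forall>x\<in>U. frechet_derivative \<phi> (at x) \<noteq> (\<lambda>v. 0)) \<and>
        M \<inter> U = {x \<in> U. \<phi> x = 0})"

text \<open>The Gauss map of the boundary of a convex body; the normal is unique when the boundary is a
  smooth hypersurface.\<close>

definition outer_unit_normal :: "'a::euclidean_space set \<Rightarrow> 'a \<Rightarrow> 'a" where
  "outer_unit_normal K p = (THE u. norm u = 1 \<and> (\<forall>y\<in>K. u \<bullet> (y - p) \<le> 0))"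

text \<open>The Gaussian curvature at \<open>p\<close> is the determinant of the Weingarten map, that is, of the
  differential \<open>W\<close> of the Gauss map acting on the tangent space, the orthogonal complement of the
  normal \<open>\<nu>\<close>. To have a determinant of an \<open>n \<times> n\<close> matrix, \<open>W\<close> is extended by the identity on the
  normal line, which does not change the determinant. The derivative within the boundary is
  determined on tangent vectors only, and only these values of \<open>W\<close> are used. With the outer normal
  the unit sphere has curvature \<open>1\<close> in every dimension.\<close>

definition has_gaussian_curvature :: "(real ^ 'n) set \<Rightarrow> real ^ 'n \<Rightarrow> real \<Rightarrow> bool" where
  "has_gaussian_curvature K p \<kappa> \<longleftrightarrow>
     (\<exists>W. (outer_unit_normal K has_derivative W) (at p within frontier K) \<and>
        (let \<nu> = outer_unit_normal K p in
          \<kappa> = det (matrix (\<lambda>v. W (v - (v \<bullet> \<nu>) *\<^sub>R \<nu>) + (v \<bullet> \<nu>) *\<^sub>R \<nu>))))"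

definition smooth_positive_curvature :: "(real ^ 'n) set \<Rightarrow> bool" where
  "smooth_positive_curvature K \<longleftrightarrow>
     smooth_hypersurface (frontier K) \<and>
     (\<forall>p\<in>frontier K. \<exists>\<kappa>>0. has_gaussian_curvature K p \<kappa>)"

definition radial_integral :: "(real ^ 'n \<Rightarrow> real) \<Rightarrow> real ^ 'n \<Rightarrow> real \<Rightarrow> real" where
  "radial_integral f x R = integral {0..R} (\<lambda>t. t ^ (CARD('n) - 2) * f (t *\<^sub>R x))"

definition perturbed_body ::
  "(real ^ 'n) set \<Rightarrow> (real ^ 'n \<Rightarrow> real) \<Rightarrow> (real ^ 'n \<Rightarrow> real) \<Rightarrow> real \<Rightarrow> (real ^ 'n) set \<Rightarrow> bool" where
  "perturbed_body L f g \<epsilon> D \<longleftrightarrow> star_body D \<and>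
     (\<forall>x\<in>sphere 0 1. radial_integral f x (radial_function D x) =
        radial_integral f x (radial_function L x) - \<epsilon> * g x)"

end

theory Submission
  imports Defs
begin

(* Let h be the gauge of L. The defining equation of D involves f only between the boundaries of L
and D, hence away from the origin, and after dividing by a positive C^2 factor it becomes
h + eps * kappa = 1 with kappa of class C^2 off the origin and independent of eps. So D is the
sublevel set {h + eps * kappa <= 1}. The square of h has positive definite Hessian: it is positive
semidefinite by convexity, and a vector in its kernel would be tangential and annihilated by the
differential of the Gauss map, contradicting positive curvature. By compactness the Hessian of
(h + eps * kappa)^2 stays positive definite near the boundary of L for small eps. If D were not
convex, some segment inside D would touch the boundary of D at a relative interior point, and there
(h + eps * kappa)^2 restricted to the segment would have a local maximum. *)

section \<open>Functions of class \<open>C\<^sup>k\<close>\<close>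

text \<open>\<open>f\<close> may be singular at the origin, so a radial integral starting at 0 need
  not be differentiable in its direction. The difference of two of them with positive upper limits
  behaves better: as in Hadamard's lemma it is the difference of the limits times an integral over
  the fixed interval [0,1]. This is where the division by a positive C^2 factor comes from. Since
  \<open>\<kappa>\<close> does not contain \<epsilon>, all constants are extrema over one compact
  set. The square is needed because \<open>h\<close> is positively homogeneous of degree one: its
  own Hessian always vanishes in the radial direction. The function h + \<epsilon> * \<kappa> is
  controlled by estimates only near the boundary of L. Near the origin and far away, monotonicity of
  the radial integrals along rays takes over; it also yields existence and uniqueness of D.
  Smoothness of \<open>h\<close> is obtained without solving an implicit equation: \<open>h\<close>
  is already known and Lipschitz, so only a formula for its derivative has to be proved, and this
  formula bootstraps to all orders.\<close>

lemma Ck_on_cong: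
  assumes "open S" "\<And>x. x \<in> S \<Longrightarrow> f x = g x" "Ck_on k f S"
  shows "Ck_on k g S"
  using assms(2,3)
proof (induction k arbitrary: f g)
  case 0
  then show ?case using continuous_on_cong by fastforce
next
  case (Suc k)
  have der: "(g has_derivative frechet_derivative f (at x)) (at x)" if "x \<in> S" for x
    by (rule has_derivative_transform_within_open[of f _ _ UNIV S])
      (use Suc.prems that assms(1) in \<open>auto simp: frechet_derivative_works[symmetric]\<close>)
  have eq: "frechet_derivative f (at x) = frechet_derivative g (at x)" if "x \<in> S" for x
    using frechet_derivative_at[OF der[OF that]] .
  show ?case
    unfolding Ck_on.simps
  proof (intro conjI ballI)
    show "g differentiable (at x)" if "x \<in> S" for x
      using der[OF that] differentiable_def by blast
    show "Ck_on k (\<lambda>x. frechet_derivative g (at x) b) S" if "b \<in> Basis" for b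
      by (rule Suc.IH[of "\<lambda>x. frechet_derivative f (at x) b"]) (use eq Suc.prems that in auto)
  qed
qed

text \<open>Lets the derivative be given by any convenient formula. Openness is what allows this
  formula to replace \<open>frechet_derivative\<close> at the next level.\<close>

lemma Ck_on_SucI:
  assumes "open S" "\<And>x. x \<in> S \<Longrightarrow> (f has_derivative f' x) (at x)"
    and "\<And>b. b \<in> Basis \<Longrightarrow> Ck_on k (\<lambda>x. f' x b) S"
  shows "Ck_on (Suc k) f S"
  unfolding Ck_on.simps
proof (intro conjI ballI)
  show "f differentiable (at x)" if "x \<in> S" for x
    using assms(2)[OF that] differentiable_def by blast
  show "Ck_on k (\<lambda>x. frechet_derivative f (at x) b) S" if "b \<in> Basis" for b
    by (rule Ck_on_cong[OF assms(1) _ assms(3)[OF that]]) (simp add: frechet_derivative_at[OF assms(2)])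
qed

lemma Ck_on_SucD:
  assumes "Ck_on (Suc k) f S"
  shows "\<And>x. x \<in> S \<Longrightarrow> (f has_derivative frechet_derivative f (at x)) (at x)"
    and "\<And>b. b \<in> Basis \<Longrightarrow> Ck_on k (\<lambda>x. frechet_derivative f (at x) b) S"
  using assms by (auto simp: frechet_derivative_works[symmetric])

lemma Ck_on_Suc_imp: "Ck_on (Suc k) f S \<Longrightarrow> Ck_on k f S"
proof (induction k arbitrary: f)
  case 0
  then show ?case
    by (auto intro!: continuous_at_imp_continuous_on differentiable_imp_continuous_within)
next
  case (Suc k)
  show ?case
    unfolding Ck_on.simps(2)[of k]
  proof (intro conjI ballI)
    show "f differentiable at x" if "x \<in> S" for x
      using Suc.prems that by simp
    show "Ck_on k (\<lambda>x. frechet_derivative f (at x) b) S" if "b \<in> Basis" for b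
      by (rule Suc.IH) (use Suc.prems that in simp)
  qed
qed

lemma Ck_on_imp_continuous_on: "Ck_on k f S \<Longrightarrow> continuous_on S f"
  by (induction k) (auto dest: Ck_on_Suc_imp simp del: Ck_on.simps(2))

lemma Ck_on_subset: "Ck_on k f S \<Longrightarrow> T \<subseteq> S \<Longrightarrow> Ck_on k f T"
  by (induction k arbitrary: f) (auto intro: continuous_on_subset)

text \<open>Needed because a smooth hypersurface comes with a different defining function near each
  of its points.\<close>

lemma Ck_on_local:
  assumes "\<And>x. x \<in> S \<Longrightarrow> \<exists>U. open U \<and> x \<in> U \<and> Ck_on k f U"
  shows "Ck_on k f S"
  using assms
proof (induction k arbitrary: f)
  case 0
  show ?case
    unfolding Ck_on.simps
  proof (rule continuous_at_imp_continuous_on, rule ballI)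
    fix x assume "x \<in> S"
    then obtain U where "open U" "x \<in> U" "continuous_on U f" using 0 by auto
    then show "isCont f x" by (simp add: continuous_on_eq_continuous_at)
  qed
next
  case (Suc k)
  show ?case
    unfolding Ck_on.simps
  proof (intro conjI ballI)
    show "f differentiable at x" if "x \<in> S" for x
      using Suc.prems[OF that] by auto
    show "Ck_on k (\<lambda>x. frechet_derivative f (at x) b) S" if "b \<in> Basis" for b
      by (rule Suc.IH) (use Suc.prems that in fastforce)
  qed
qed

lemma Ck_on_const: "open S \<Longrightarrow> Ck_on k (\<lambda>x. c) S"
proof (induction k arbitrary: c)
  case (Suc k)
  show ?case
    by (rule Ck_on_SucI[where f' = "\<lambda>_ _. 0"]) (use Suc in \<open>auto intro: has_derivative_const\<close>)
qed auto

lemma Ck_on_bounded_linear: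
  assumes "open S" "bounded_linear l"
  shows "Ck_on k l S"
proof (cases k)
  case 0
  then show ?thesis using assms by (simp add: linear_continuous_on)
next
  case (Suc k')
  show ?thesis
    unfolding Suc using assms
    by (intro Ck_on_SucI[where f' = "\<lambda>_. l"] bounded_linear_imp_has_derivative Ck_on_const)
qed

lemma Ck_on_add:
  assumes "open S"
  shows "Ck_on k f S \<Longrightarrow> Ck_on k g S \<Longrightarrow> Ck_on k (\<lambda>x. f x + g x) S"
proof (induction k arbitrary: f g)
  case 0
  then show ?case by (auto intro: continuous_intros)
next
  case (Suc k)
  show ?case
    by (rule Ck_on_SucI[where f' = "\<lambda>x b. frechet_derivative f (at x) b + frechet_derivative g (at x) b"])
      (use assms Suc.prems in \<open>auto intro!: Suc.IH has_derivative_add simp: frechet_derivative_works[symmetric]\<close>)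
qed

lemma Ck_on_mult:
  assumes "open S"
  shows "Ck_on k f S \<Longrightarrow> Ck_on k g S \<Longrightarrow> Ck_on k (\<lambda>x. f x * g x) S"
proof (induction k arbitrary: f g)
  case 0
  then show ?case by (auto intro: continuous_intros)
next
  case (Suc k)
  show ?case
  proof (rule Ck_on_SucI[where f' = "\<lambda>x b. f x * frechet_derivative g (at x) b + frechet_derivative f (at x) b * g x"])
    show "((\<lambda>x. f x * g x) has_derivative
         (\<lambda>b. f x * frechet_derivative g (at x) b + frechet_derivative f (at x) b * g x)) (at x)"
      if "x \<in> S" for x
      using Suc.prems[THEN Ck_on_SucD(1), OF that] by (rule has_derivative_mult)
    show "Ck_on k (\<lambda>x. f x * frechet_derivative g (at x) b + frechet_derivative f (at x) b * g x) S"
      if "b \<in> Basis" for b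
      using Suc.prems[THEN Ck_on_SucD(2), OF that] Suc.prems[THEN Ck_on_Suc_imp]
      by (intro Ck_on_add assms Suc.IH)
  qed (fact assms)
qed

lemma Ck_on_uminus: "open S \<Longrightarrow> Ck_on k f S \<Longrightarrow> Ck_on k (\<lambda>x. - f x) S"
  using Ck_on_mult[of S k "\<lambda>_. -1" f] Ck_on_const[of S k "-1"] by simp

lemma Ck_on_diff: "open S \<Longrightarrow> Ck_on k f S \<Longrightarrow> Ck_on k g S \<Longrightarrow> Ck_on k (\<lambda>x. f x - g x) S"
  using Ck_on_add[of S k f "\<lambda>x. - g x"] Ck_on_uminus[of S k g] by simp

lemma Ck_on_sum:
  assumes "open S"
  shows "(\<And>i. i \<in> I \<Longrightarrow> Ck_on k (f i) S) \<Longrightarrow> Ck_on k (\<lambda>x. \<Sum>i\<in>I. f i x) S"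
  by (induction I rule: infinite_finite_induct) (auto intro: Ck_on_const Ck_on_add assms)

lemma Ck_on_power: "open S \<Longrightarrow> Ck_on k f S \<Longrightarrow> Ck_on k (\<lambda>x. f x ^ m) S"
  by (induction m) (auto intro: Ck_on_const Ck_on_mult)

lemma Ck_on_inverse:
  assumes "open S" "\<And>x. x \<in> S \<Longrightarrow> f x \<noteq> 0"
  shows "Ck_on k f S \<Longrightarrow> Ck_on k (\<lambda>x. inverse (f x)) S"
proof (induction k)
  case 0
  then show ?case using assms by (auto intro: continuous_intros)
next
  case (Suc k)
  show ?case
  proof (rule Ck_on_SucI[where f' = "\<lambda>x b. - (inverse (f x) * frechet_derivative f (at x) b * inverse (f x))"])
    show "((\<lambda>x. inverse (f x)) has_derivative
         (\<lambda>b. - (inverse (f x) * frechet_derivative f (at x) b * inverse (f x)))) (at x)"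
      if "x \<in> S" for x
      by (rule Deriv.has_derivative_inverse[OF assms(2) Ck_on_SucD(1)[OF Suc.prems]]) (use that in auto)
    show "Ck_on k (\<lambda>x. - (inverse (f x) * frechet_derivative f (at x) b * inverse (f x))) S"
      if "b \<in> Basis" for b
      using Ck_on_SucD(2)[OF Suc.prems that] Suc.IH[OF Ck_on_Suc_imp[OF Suc.prems]]
      by (intro Ck_on_uminus Ck_on_mult assms)
  qed (fact assms)
qed

lemma Ck_on_divide:
  assumes "open S" "\<And>x. x \<in> S \<Longrightarrow> g x \<noteq> 0" "Ck_on k f S" "Ck_on k g S"
  shows "Ck_on k (\<lambda>x. f x / g x) S"
  unfolding divide_inverse using assms by (intro Ck_on_mult Ck_on_inverse)

text \<open>\<open>Ck_on\<close> speaks of real-valued functions, so the inner map enters through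
  its coordinates. By the chain rule the derivative is a sum of products of partial derivatives of
  \<open>f\<close> composed with \<open>F\<close>, to which the induction hypothesis applies, and
  partial derivatives of the coordinates of \<open>F\<close>.\<close>

lemma Ck_on_compose:
  fixes F :: "'b::euclidean_space \<Rightarrow> 'a::euclidean_space"
  assumes "open S" "open T" "F ` S \<subseteq> T"
  shows "Ck_on k f T \<Longrightarrow> (\<And>i. i \<in> Basis \<Longrightarrow> Ck_on k (\<lambda>x. F x \<bullet> i) S) \<Longrightarrow> Ck_on k (\<lambda>x. f (F x)) S"
proof (induction k arbitrary: f)
  case 0
  have "continuous_on S F"
    unfolding continuous_on_componentwise[of S F] using 0 by simp
  then show ?case using 0 assms(3) by (auto intro: continuous_on_compose2)
next
  case (Suc k)
  let ?D = "\<lambda>i x. frechet_derivative (\<lambda>x. F x \<bullet> i) (at x)"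
  let ?f' = "\<lambda>x b. \<Sum>i\<in>Basis. frechet_derivative f (at (F x)) i * ?D i x b"
  show ?case
  proof (rule Ck_on_SucI[where f' = ?f'])
    show "((\<lambda>x. f (F x)) has_derivative ?f' x) (at x)" if x: "x \<in> S" for x
    proof -
      have "(F has_derivative (\<lambda>b. \<Sum>i\<in>Basis. ?D i x b *\<^sub>R i)) (at x)"
        unfolding has_derivative_componentwise_within[of F]
        using Ck_on_SucD(1)[OF Suc.prems(2) x]
        by (auto simp: inner_sum_left inner_Basis if_distrib[of "\<lambda>t. _ * t"] sum.delta cong: if_cong)
      moreover have f: "(f has_derivative frechet_derivative f (at (F x))) (at (F x))"
        using Ck_on_SucD(1)[OF Suc.prems(1)] x assms(3) by blast
      ultimately have "((\<lambda>x. f (F x)) has_derivative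
          (\<lambda>b. frechet_derivative f (at (F x)) (\<Sum>i\<in>Basis. ?D i x b *\<^sub>R i))) (at x)"
        by (rule has_derivative_compose)
      moreover have "linear (frechet_derivative f (at (F x)))"
        using f has_derivative_linear by blast
      ultimately show ?thesis
        by (simp add: linear_sum linear_scale mult.commute)
    qed
    show "Ck_on k (\<lambda>x. ?f' x b) S" if "b \<in> Basis" for b
      using Suc.prems that
      by (intro Ck_on_sum Ck_on_mult assms(1) Suc.IH[of "\<lambda>y. frechet_derivative f (at y) i" for i]
          Ck_on_SucD(2)[OF Suc.prems(1)] Ck_on_SucD(2)[OF Suc.prems(2)] Ck_on_Suc_imp[OF Suc.prems(2)])
  qed (fact assms)
qed

text \<open>The derivative of the norm is a linear function divided by the norm, so each order of
  smoothness gives the next.\<close>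

lemma Ck_on_norm: "Ck_on k (norm :: 'a::euclidean_space \<Rightarrow> real) (- {0})"
proof (induction k)
  case 0
  then show ?case by (simp add: continuous_on_norm_id)
next
  case (Suc k)
  show ?case
  proof (rule Ck_on_SucI[where f' = "\<lambda>x b. b \<bullet> sgn x"])
    show "(norm has_derivative (\<lambda>b. b \<bullet> sgn x)) (at x)" if "x \<in> - {0}" for x :: 'a
      using that by (intro has_derivative_norm) auto
    have "Ck_on k (\<lambda>x::'a. (b \<bullet> x) / norm x) (- {0})" for b
      by (intro Ck_on_divide Suc.IH Ck_on_bounded_linear) (auto simp: bounded_linear_inner_right)
    then show "Ck_on k (\<lambda>x. b \<bullet> sgn x) (- {0})" for b :: 'a
      by (simp add: sgn_div_norm field_simps)
  qed auto
qed

text \<open>Differentiation under the integral sign, repeated. The kernel is regular on an open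
  neighbourhood of the strip, so that its full derivative exists at the endpoints of the interval
  too; only the directions \<open>(0, i)\<close> occur.\<close>

lemma Ck_on_integral:
  fixes K :: "real \<times> 'a::euclidean_space \<Rightarrow> real"
  assumes "open U" "open S" "{a..b} \<times> S \<subseteq> U"
    and "Ck_on k K U"
  shows "Ck_on k (\<lambda>y. integral {a..b} (\<lambda>u. K (u, y))) S"
proof -
  have swap: "continuous_on (S \<times> {a..b}) (\<lambda>p. Q (snd p, fst p))"
    if "continuous_on U Q" for Q :: "real \<times> 'a \<Rightarrow> real"
  proof -
    have "continuous_on (S \<times> {a..b}) (\<lambda>p. (snd p, fst p))"
      by (intro continuous_intros)
    then show ?thesis
      by (rule continuous_on_compose2[OF that]) (use assms(3) in auto)
  qed
  have slice: "continuous_on {a..b} (\<lambda>u. Q (u, y))"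
    if "continuous_on U Q" "y \<in> S" for Q :: "real \<times> 'a \<Rightarrow> real" and y
  proof -
    have "continuous_on {a..b} (\<lambda>u. (u, y))"
      by (intro continuous_intros)
    then show ?thesis
      by (rule continuous_on_compose2[OF that(1)]) (use assms(3) that(2) in auto)
  qed
  show ?thesis
    using assms(4)
  proof (induction k arbitrary: K)
    case 0
    then have "continuous_on (S \<times> cbox a b) (\<lambda>(y, u). K (u, y))"
      using swap by (simp add: split_beta)
    then have "continuous_on S (\<lambda>y. integral (cbox a b) (\<lambda>u. K (u, y)))"
      by (rule integral_continuous_on_param)
    then show ?case by simp
  next
    case (Suc k)
    have in_Basis: "(0, i) \<in> (Basis :: (real \<times> 'a) set)" if "i \<in> Basis" for i
      using that by (simp add: Basis_prod_def)
    let ?d = "\<lambda>i z. frechet_derivative K (at z) (0, i)"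
    \<comment> \<open>The partial derivative in \<open>y\<close>, packaged as a bounded linear
      function because the Leibniz rule integrates it as a vector.\<close>
    define fx where "fx = (\<lambda>y u. \<Sum>i\<in>Basis. ?d i (u, y) *\<^sub>R (blinfun_inner_left i :: 'a \<Rightarrow>\<^sub>L real))"
    have Kder: "(K has_derivative frechet_derivative K (at (u, y))) (at (u, y))" if "u \<in> {a..b}" "y \<in> S" for u y
      by (rule Ck_on_SucD(1)[OF Suc.prems]) (use that assms(3) in auto)
    have fx: "((\<lambda>y. K (u, y)) has_derivative fx y u) (at y)" if "u \<in> {a..b}" "y \<in> S" for u y
    proof -
      have "((\<lambda>y. (u, y)) has_derivative (\<lambda>v. (0, v))) (at y)"
        by (auto intro!: derivative_eq_intros)
      then have "((\<lambda>y. K (u, y)) has_derivative (\<lambda>v. frechet_derivative K (at (u, y)) (0, v))) (at y)"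
        using Kder[OF that] by (rule has_derivative_compose)
      moreover have "frechet_derivative K (at (u, y)) (0, v) = fx y u v" for v
      proof -
        have eq: "(\<Sum>i\<in>Basis. (v \<bullet> i) *\<^sub>R (0::real, i)) = (0, v)"
          using euclidean_representation[of v] by (simp add: prod_eq_iff fst_sum snd_sum)
        have lin: "linear (frechet_derivative K (at (u, y)))"
          using Kder[OF that] has_derivative_linear by blast
        have "frechet_derivative K (at (u, y)) (0, v) = (\<Sum>i\<in>Basis. (v \<bullet> i) * ?d i (u, y))"
          unfolding eq[symmetric] linear_sum[OF lin] linear_scale[OF lin] real_scaleR_def ..
        then show ?thesis
          by (simp add: fx_def blinfun.sum_left blinfun.scaleR_left mult.commute)
      qed
      ultimately show ?thesis by simp
    qed
    have contd: "continuous_on U (?d i)" if "i \<in> Basis" for i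
      using Ck_on_imp_continuous_on[OF Ck_on_SucD(2)[OF Suc.prems in_Basis[OF that]]] .
    have cont_fx: "continuous_on (S \<times> {a..b}) (\<lambda>(y, u). fx y u)"
      unfolding fx_def split_beta by (intro continuous_intros swap contd)
    have contK: "continuous_on {a..b} (\<lambda>u. K (u, y))" if "y \<in> S" for y
      using slice[OF Ck_on_imp_continuous_on[OF Suc.prems] that] .
    show ?case
    proof (rule Ck_on_SucI[where f' = "\<lambda>y. blinfun_apply (integral {a..b} (fx y))"])
      show "((\<lambda>y. integral {a..b} (\<lambda>u. K (u, y))) has_derivative integral {a..b} (fx y)) (at y)"
        if y: "y \<in> S" for y
      proof -
        obtain e where e: "e > 0" "ball y e \<subseteq> S" using assms(2) y openE by blast
        have "((\<lambda>y. integral (cbox a b) (\<lambda>u. K (u, y))) has_derivative integral (cbox a b) (fx y))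
            (at y within ball y e)"
        proof (rule leibniz_rule)
          show "((\<lambda>y. K (t, y)) has_derivative fx x t) (at x within ball y e)"
            if "x \<in> ball y e" "t \<in> cbox a b" for x t
            by (rule has_derivative_at_withinI[OF fx]) (use that e in auto)
          show "(\<lambda>u. K (u, x)) integrable_on cbox a b" if "x \<in> ball y e" for x
            using integrable_continuous_real[OF contK[of x]] that e(2) by auto
          show "continuous_on (ball y e \<times> cbox a b) (\<lambda>(x, t). fx x t)"
            using continuous_on_subset[OF cont_fx, of "ball y e \<times> {a..b}"] e(2) by auto
        qed (use e in auto)
        then show ?thesis using e at_within_open[of y "ball y e"] by simp
      qed
      show "Ck_on k (\<lambda>y. integral {a..b} (fx y) i) S" if i: "i \<in> Basis" for i
      proof (rule Ck_on_cong[OF assms(2)])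
        show "Ck_on k (\<lambda>y. integral {a..b} (\<lambda>u. ?d i (u, y))) S"
          by (rule Suc.IH) (use Ck_on_SucD(2)[OF Suc.prems in_Basis[OF i]] in simp)
        show "integral {a..b} (\<lambda>u. ?d i (u, y)) = integral {a..b} (fx y) i" if y: "y \<in> S" for y
        proof -
          have "fx y integrable_on {a..b}"
            unfolding fx_def by (intro integrable_continuous_real continuous_intros slice contd y)
          then have "integral {a..b} (fx y) i = integral {a..b} (\<lambda>u. fx y u i)"
            by (simp add: blinfun_apply_integral)
          also have "(\<lambda>u. fx y u i) = (\<lambda>u. ?d i (u, y))"
            using i by (simp add: fx_def blinfun.sum_left blinfun.scaleR_left inner_Basis
                if_distrib[of "\<lambda>t. _ * t"] sum.delta cong: if_cong)
          finally show ?thesis by simp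
        qed
      qed
    qed (fact assms)
  qed
qed

section \<open>Second directional derivatives\<close>

text \<open>The Hessian as a bilinear form: the derivative along \<open>v\<close> of the derivative
  along \<open>w\<close>. Written out in basis partial derivatives, it inherits its continuity
  directly from \<open>Ck_on\<close>; its symmetry is a theorem.\<close>

definition dir_deriv2 :: "('a::euclidean_space \<Rightarrow> real) \<Rightarrow> 'a \<Rightarrow> 'a \<Rightarrow> 'a \<Rightarrow> real" where
  "dir_deriv2 f x v w = (\<Sum>j\<in>Basis. (w \<bullet> j) *
     (\<Sum>i\<in>Basis. (v \<bullet> i) * frechet_derivative (\<lambda>z. frechet_derivative f (at z) j) (at x) i))"

lemma has_derivative_Basis_sum:
  assumes "(f has_derivative f') (at x)"
  shows "f' w = (\<Sum>j\<in>Basis. (w \<bullet> j) *\<^sub>R f' j)"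
proof -
  have lin: "linear f'"
    using assms has_derivative_linear by blast
  show ?thesis
    by (subst (1) euclidean_representation[symmetric, of w])
      (simp only: linear_sum[OF lin] linear_scale[OF lin])
qed

lemma has_real_derivative_along_line:
  assumes "(f has_derivative f') (at (x + t *\<^sub>R v))"
  shows "((\<lambda>s. f (x + s *\<^sub>R v)) has_real_derivative f' v) (at t)"
proof -
  have "((\<lambda>s. x + s *\<^sub>R v) has_derivative (\<lambda>s. s *\<^sub>R v)) (at t)"
    by (auto intro!: derivative_eq_intros)
  then have "((\<lambda>s. f (x + s *\<^sub>R v)) has_derivative (\<lambda>s. f' (s *\<^sub>R v))) (at t)"
    using assms by (rule has_derivative_compose)
  moreover have "f' (s *\<^sub>R v) = f' v * s" for s
    using linear_scale[OF has_derivative_linear[OF assms]] by (simp add: mult.commute)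
  ultimately show ?thesis
    by (simp add: has_field_derivative_def)
qed

lemma Ck_on_2D:
  assumes "Ck_on 2 f S"
  shows "\<And>x. x \<in> S \<Longrightarrow> (f has_derivative frechet_derivative f (at x)) (at x)"
    and "\<And>x b. x \<in> S \<Longrightarrow> b \<in> Basis \<Longrightarrow> ((\<lambda>z. frechet_derivative f (at z) b) has_derivative
           frechet_derivative (\<lambda>z. frechet_derivative f (at z) b) (at x)) (at x)"
    and "\<And>b. b \<in> Basis \<Longrightarrow> continuous_on S (\<lambda>z. frechet_derivative f (at z) b)"
    and "\<And>b c. b \<in> Basis \<Longrightarrow> c \<in> Basis \<Longrightarrow>
           continuous_on S (\<lambda>x. frechet_derivative (\<lambda>z. frechet_derivative f (at z) b) (at x) c)"
proof -
  have 2: "Ck_on (Suc (Suc 0)) f S"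
    using assms by (simp only: numeral_2_eq_2)
  show "(f has_derivative frechet_derivative f (at x)) (at x)" if "x \<in> S" for x
    using Ck_on_SucD(1)[OF 2 that] .
  fix b :: 'a
  assume b: "b \<in> Basis"
  have 1: "Ck_on (Suc 0) (\<lambda>z. frechet_derivative f (at z) b) S"
    using Ck_on_SucD(2)[OF 2 b] .
  show "((\<lambda>z. frechet_derivative f (at z) b) has_derivative
           frechet_derivative (\<lambda>z. frechet_derivative f (at z) b) (at x)) (at x)" if "x \<in> S" for x
    using Ck_on_SucD(1)[OF 1 that] .
  show "continuous_on S (\<lambda>z. frechet_derivative f (at z) b)"
    using Ck_on_imp_continuous_on[OF 1] .
  show "continuous_on S (\<lambda>x. frechet_derivative (\<lambda>z. frechet_derivative f (at z) b) (at x) c)"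
    if "c \<in> Basis" for c
    using Ck_on_SucD(2)[OF 1 that] by simp
qed

lemma frechet_derivative_eq_sum:
  assumes "Ck_on 2 f S" "x \<in> S"
  shows "frechet_derivative f (at x) w = (\<Sum>j\<in>Basis. (w \<bullet> j) * frechet_derivative f (at x) j)"
  using has_derivative_Basis_sum[OF Ck_on_2D(1)[OF assms]] unfolding real_scaleR_def .

text \<open>With \<open>has_real_derivative_along_line\<close>, this makes
  \<open>dir_deriv2 f x v v\<close> the second derivative of \<open>f\<close> along a line.\<close>

lemma has_real_derivative_frechet_along_line:
  assumes "Ck_on 2 f S" "open S" "x + t *\<^sub>R v \<in> S"
  shows "((\<lambda>s. frechet_derivative f (at (x + s *\<^sub>R v)) w) has_real_derivative
     dir_deriv2 f (x + t *\<^sub>R v) v w) (at t)"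
proof -
  let ?D = "\<lambda>j z. frechet_derivative f (at z) j"
  have "((\<lambda>s. \<Sum>j\<in>Basis. (w \<bullet> j) * ?D j (x + s *\<^sub>R v)) has_real_derivative
     (\<Sum>j\<in>Basis. (w \<bullet> j) * frechet_derivative (?D j) (at (x + t *\<^sub>R v)) v)) (at t)"
    by (intro DERIV_sum DERIV_cmult has_real_derivative_along_line[OF Ck_on_2D(2)[OF assms(1,3)]])
  also have "(\<Sum>j\<in>Basis. (w \<bullet> j) * frechet_derivative (?D j) (at (x + t *\<^sub>R v)) v)
      = dir_deriv2 f (x + t *\<^sub>R v) v w"
    unfolding dir_deriv2_def
    by (intro sum.cong refl arg_cong2[where f = "(*)"])
      (use has_derivative_Basis_sum[OF Ck_on_2D(2)[OF assms(1,3)]] in simp)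
  finally show ?thesis
  proof (rule has_field_derivative_transform_within_open)
    show "open ((\<lambda>s. x + s *\<^sub>R v) -` S)"
      by (intro open_vimage assms(2) continuous_intros)
  qed (use assms frechet_derivative_eq_sum[OF assms(1)] in auto)
qed

text \<open>Joint continuity in point and direction serves to take extrema over compact sets of such
  pairs; the version with fixed directions serves Schwarz's theorem.\<close>

lemma continuous_on_dir_deriv2:
  assumes "Ck_on 2 f S"
  shows "continuous_on (S \<times> UNIV) (\<lambda>p. dir_deriv2 f (fst p) (snd p) (snd p))"
    and "continuous_on S (\<lambda>x. dir_deriv2 f x v w)"
proof -
  have fst: "continuous_on (S \<times> UNIV) fst" "fst ` (S \<times> UNIV) \<subseteq> S"
    by (auto intro: continuous_on_fst[OF continuous_on_id])
  show "continuous_on (S \<times> UNIV) (\<lambda>p. dir_deriv2 f (fst p) (snd p) (snd p))"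
    unfolding dir_deriv2_def
    by (intro continuous_on_sum continuous_on_mult continuous_on_inner continuous_on_snd continuous_on_id
        continuous_on_const continuous_on_compose2[OF Ck_on_2D(4)[OF assms] fst])
  show "continuous_on S (\<lambda>x. dir_deriv2 f x v w)"
    unfolding dir_deriv2_def
    by (intro continuous_on_sum continuous_on_mult continuous_on_const Ck_on_2D(4)[OF assms])
qed

lemma continuous_on_dir_deriv:
  assumes "Ck_on 2 f S"
  shows "continuous_on (S \<times> UNIV) (\<lambda>p. frechet_derivative f (at (fst p)) (snd p))"
proof -
  have fst: "continuous_on (S \<times> UNIV) fst" "fst ` (S \<times> UNIV) \<subseteq> S"
    by (auto intro: continuous_on_fst[OF continuous_on_id])
  have "continuous_on (S \<times> UNIV) (\<lambda>p. \<Sum>j\<in>Basis. (snd p \<bullet> j) * frechet_derivative f (at (fst p)) j)"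
    by (intro continuous_on_sum continuous_on_mult continuous_on_inner continuous_on_snd continuous_on_id
        continuous_on_const continuous_on_compose2[OF Ck_on_2D(3)[OF assms] fst])
  moreover have "frechet_derivative f (at (fst p)) (snd p)
      = (\<Sum>j\<in>Basis. (snd p \<bullet> j) * frechet_derivative f (at (fst p)) j)" if "p \<in> S \<times> UNIV" for p
    using frechet_derivative_eq_sum[OF assms] that by auto
  ultimately show ?thesis
    using continuous_on_cong by (metis (no_types, lifting))
qed

text \<open>The mean value theorem is applied along \<open>w\<close> to a difference in
  \<open>v\<close>, then along \<open>v\<close> to the resulting derivative. The left-hand side is
  symmetric in \<open>v\<close> and \<open>w\<close>, which is the point of the formula.\<close>

lemma second_difference_eq:
  assumes "Ck_on 2 f S" "open S" "ball x r \<subseteq> S" "0 < t" "t * (norm v + norm w) < r"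
  obtains z where "dist x z \<le> t * (norm v + norm w)"
    and "f (x + t *\<^sub>R v + t *\<^sub>R w) - f (x + t *\<^sub>R v) - f (x + t *\<^sub>R w) + f x = t\<^sup>2 * dir_deriv2 f z v w"
proof -
  have dist: "dist x (x + a *\<^sub>R v + b *\<^sub>R w) \<le> t * (norm v + norm w)"
    if "0 \<le> a" "a \<le> t" "0 \<le> b" "b \<le> t" for a b
  proof -
    have "norm (a *\<^sub>R v + b *\<^sub>R w) \<le> a * norm v + b * norm w"
      using norm_triangle_ineq[of "a *\<^sub>R v" "b *\<^sub>R w"] that by simp
    also have "\<dots> \<le> t * norm v + t * norm w"
      using that by (intro add_mono mult_right_mono) auto
    finally show ?thesis
      by (simp add: dist_norm norm_minus_commute algebra_simps)
  qed
  have mem: "x + a *\<^sub>R v + b *\<^sub>R w \<in> S" if "0 \<le> a" "a \<le> t" "0 \<le> b" "b \<le> t" for a b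
    using dist[OF that] assms(3,5) by (auto simp: subset_iff)
  let ?G = "\<lambda>b. f (x + t *\<^sub>R v + b *\<^sub>R w) - f (x + b *\<^sub>R w)"
  have "\<exists>b. 0 < b \<and> b < t \<and> ?G t - ?G 0 = (t - 0) *
      (frechet_derivative f (at (x + t *\<^sub>R v + b *\<^sub>R w)) w - frechet_derivative f (at (x + b *\<^sub>R w)) w)"
  proof (rule MVT2)
    show "(?G has_real_derivative frechet_derivative f (at (x + t *\<^sub>R v + b *\<^sub>R w)) w
        - frechet_derivative f (at (x + b *\<^sub>R w)) w) (at b)" if "0 \<le> b" "b \<le> t" for b
      using mem[of t b] mem[of 0 b] that assms(4)
      by (intro DERIV_diff has_real_derivative_along_line Ck_on_2D(1)[OF assms(1)]) auto
  qed (fact assms(4))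
  then obtain b where b: "0 < b" "b < t" "?G t - ?G 0 = t *
      (frechet_derivative f (at (x + t *\<^sub>R v + b *\<^sub>R w)) w - frechet_derivative f (at (x + b *\<^sub>R w)) w)"
    by auto
  let ?H = "\<lambda>a. frechet_derivative f (at (x + b *\<^sub>R w + a *\<^sub>R v)) w"
  have "\<exists>a. 0 < a \<and> a < t \<and> ?H t - ?H 0 = (t - 0) * dir_deriv2 f (x + b *\<^sub>R w + a *\<^sub>R v) v w"
  proof (rule MVT2)
    show "(?H has_real_derivative dir_deriv2 f (x + b *\<^sub>R w + a *\<^sub>R v) v w) (at a)" if "0 \<le> a" "a \<le> t" for a
      using mem[of a b] that b
      by (intro has_real_derivative_frechet_along_line[OF assms(1,2)]) (auto simp: add_ac)
  qed (fact assms(4))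
  then obtain a where a: "0 < a" "a < t" "?H t - ?H 0 = t * dir_deriv2 f (x + b *\<^sub>R w + a *\<^sub>R v) v w"
    by auto
  show thesis
  proof (rule that[of "x + b *\<^sub>R w + a *\<^sub>R v"])
    show "dist x (x + b *\<^sub>R w + a *\<^sub>R v) \<le> t * (norm v + norm w)"
      using dist[of a b] a b by (simp add: add_ac)
    show "f (x + t *\<^sub>R v + t *\<^sub>R w) - f (x + t *\<^sub>R v) - f (x + t *\<^sub>R w) + f x =
        t\<^sup>2 * dir_deriv2 f (x + b *\<^sub>R w + a *\<^sub>R v) v w"
      using a(3) b(3) by (simp add: power2_eq_square add_ac)
  qed
qed

text \<open>Schwarz's theorem: one symmetric second difference equals \<open>t\<^sup>2\<close> times
  either mixed derivative at points close to \<open>x\<close>. If the two differed at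
  \<open>x\<close>, continuity to within half the gap would contradict this.\<close>

lemma dir_deriv2_commute:
  assumes "Ck_on 2 f S" "open S" "x \<in> S"
  shows "dir_deriv2 f x v w = dir_deriv2 f x w v"
proof (rule ccontr)
  assume ne: "\<not> ?thesis"
  define e where "e = \<bar>dir_deriv2 f x v w - dir_deriv2 f x w v\<bar> / 2"
  have e: "e > 0" using ne by (simp add: e_def)
  have cont: "isCont (\<lambda>z. dir_deriv2 f z a b) x" for a b
    using continuous_on_dir_deriv2(2)[OF assms(1)] assms(2,3) by (simp add: continuous_on_eq_continuous_at)
  obtain r where r: "r > 0" "ball x r \<subseteq> S"
    using assms(2,3) openE by blast
  obtain d1 where d1: "d1 > 0" "\<And>z. dist z x < d1 \<Longrightarrow> dist (dir_deriv2 f z v w) (dir_deriv2 f x v w) < e"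
    using cont[of v w] e unfolding continuous_at_eps_delta dist_norm by blast
  obtain d2 where d2: "d2 > 0" "\<And>z. dist z x < d2 \<Longrightarrow> dist (dir_deriv2 f z w v) (dir_deriv2 f x w v) < e"
    using cont[of w v] e unfolding continuous_at_eps_delta dist_norm by blast
  define m where "m = min r (min d1 d2)"
  define t where "t = m / (2 * (norm v + norm w + 1))"
  have m: "m > 0" using r d1 d2 by (simp add: m_def)
  have n1: "norm v + norm w + 1 > 0"
    by (meson add_nonneg_pos add_nonneg_nonneg norm_ge_zero zero_less_one)
  have t: "t > 0" using m n1 by (simp add: t_def)
  have "t * (norm v + norm w + 1) = m / 2"
    using n1 by (simp add: t_def field_simps)
  then have tm: "t * (norm v + norm w) < m"
    using m t by (simp add: algebra_simps)
  obtain z where z: "dist x z \<le> t * (norm v + norm w)"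
    "f (x + t *\<^sub>R v + t *\<^sub>R w) - f (x + t *\<^sub>R v) - f (x + t *\<^sub>R w) + f x = t\<^sup>2 * dir_deriv2 f z v w"
    using second_difference_eq[OF assms(1,2) r(2) t, of v w] tm by (auto simp: m_def)
  obtain z' where z': "dist x z' \<le> t * (norm w + norm v)"
    "f (x + t *\<^sub>R w + t *\<^sub>R v) - f (x + t *\<^sub>R w) - f (x + t *\<^sub>R v) + f x = t\<^sup>2 * dir_deriv2 f z' w v"
    using second_difference_eq[OF assms(1,2) r(2) t, of w v] tm by (auto simp: m_def add.commute)
  have "t\<^sup>2 * dir_deriv2 f z v w = t\<^sup>2 * dir_deriv2 f z' w v"
    using z(2) z'(2) by (simp add: add.commute add.left_commute diff_diff_eq)
  then have "dir_deriv2 f z v w = dir_deriv2 f z' w v"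
    using t by simp
  moreover have "dist (dir_deriv2 f z v w) (dir_deriv2 f x v w) < e"
    using z(1) tm by (intro d1) (auto simp: m_def dist_commute)
  moreover have "dist (dir_deriv2 f z' w v) (dir_deriv2 f x w v) < e"
    using z'(1) tm by (intro d2) (auto simp: m_def dist_commute add.commute)
  ultimately show False
    unfolding dist_real_def e_def by (auto simp: abs_if split: if_splits)
qed

text \<open>At a local maximum \<open>f'\<close> vanishes; if \<open>c\<close> were positive,
  \<open>f'\<close> would be positive just to the right of 0 and \<open>f\<close> would exceed
  \<open>f 0\<close> there.\<close>

lemma second_derivative_le_0_at_local_max:
  fixes f :: "real \<Rightarrow> real"
  assumes "d > 0" "\<And>s. \<bar>s\<bar> < d \<Longrightarrow> (f has_real_derivative f' s) (at s)"
    and "(f' has_real_derivative c) (at 0)" "\<And>s. \<bar>s\<bar> < d \<Longrightarrow> f s \<le> f 0"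
  shows "c \<le> 0"
proof (rule ccontr)
  assume "\<not> c \<le> 0"
  then obtain e where e: "e > 0" "\<And>h. 0 < h \<Longrightarrow> h < e \<Longrightarrow> f' 0 < f' h"
    using DERIV_pos_inc_right[OF assms(3)] by auto
  have "f' 0 = 0"
    using DERIV_local_max[OF assms(2)[of 0] assms(1)] assms(1,4) by simp
  define s where "s = min d e / 2"
  have s: "0 < s" "s < d" "s < e"
    using assms(1) e(1) by (auto simp: s_def)
  have "\<exists>z>0. z < s \<and> f s - f 0 = (s - 0) * f' z"
    by (rule MVT2) (use s assms(2) in auto)
  then obtain z where z: "0 < z" "z < s" "f s - f 0 = s * f' z"
    by auto
  have "f' z > 0" using e(2)[of z] z s \<open>f' 0 = 0\<close> by simp
  then have "f s > f 0" using z(3) s by (metis diff_gt_0_iff_gt mult_pos_pos)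
  then show False using assms(4)[of s] s by simp
qed

section \<open>Star bodies\<close>

text \<open>Inflate the segment from \<open>0\<close>: the first scaled copy of it that leaves the interior touches the
  boundary at a relative interior point of the segment while still lying in \<open>D\<close>.\<close>

lemma convex_if_no_segment_touches_frontier:
  fixes D :: "'a::euclidean_space set"
  assumes "closed D" "0 \<in> interior D"
    and shrink: "\<And>x s. x \<in> D \<Longrightarrow> 0 \<le> s \<Longrightarrow> s < 1 \<Longrightarrow> s *\<^sub>R x \<in> interior D"
    and strict: "\<And>p v d. p \<in> D \<Longrightarrow> p \<notin> interior D \<Longrightarrow> v \<noteq> 0 \<Longrightarrow> d > 0 \<Longrightarrow>
      \<exists>s. \<bar>s\<bar> < d \<and> p + s *\<^sub>R v \<notin> D"
  shows "convex D"
proof (rule ccontr)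
  assume "\<not> convex D"
  then obtain x y t0 where xy: "x \<in> D" "y \<in> D" and t0: "0 \<le> t0" "t0 \<le> 1" "(1 - t0) *\<^sub>R x + t0 *\<^sub>R y \<notin> D"
    unfolding convex_alt by blast
  define M where "M = (\<lambda>p::real \<times> real. fst p *\<^sub>R ((1 - snd p) *\<^sub>R x + snd p *\<^sub>R y))"
  define Z where "Z = ({0..1} \<times> {0..1}) \<inter> M -` (- interior D)"
  have contM: "continuous_on UNIV M"
    unfolding M_def by (intro continuous_intros)
  have "closed (M -` (- interior D))"
    by (rule closed_vimage) (use contM in auto)
  then have "compact Z"
    unfolding Z_def by (intro compact_Int_closed compact_Times compact_Icc)
  moreover have "(1, t0) \<in> Z"
    using t0 interior_subset by (auto simp: Z_def M_def)
  moreover have "continuous_on Z fst"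
    by (intro continuous_intros)
  ultimately obtain q where q: "q \<in> Z" "\<And>r. r \<in> Z \<Longrightarrow> fst q \<le> fst r"
    using continuous_attains_inf[of Z fst] by blast
  define s t where "s = fst q" and "t = snd q"
  have st: "0 \<le> s" "s \<le> 1" "0 \<le> t" "t \<le> 1" and notin: "M (s, t) \<notin> interior D"
    using q(1) by (auto simp: Z_def s_def t_def)
  have "s \<noteq> 0"
    using notin assms(2) by (auto simp: M_def)
  with st have "s > 0" by simp
  \<comment> \<open>Below the scale \<open>s\<close> the whole segment lies in the interior, by
    minimality of \<open>s\<close>. The copy at scale \<open>s\<close> is a limit of these and D is
    closed.\<close>
  have inD: "M (s, t') \<in> D" if "0 \<le> t'" "t' \<le> 1" for t'
  proof -
    have "M (s', t') \<in> D" if "s' \<in> {0..<s}" for s'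
    proof (rule ccontr)
      assume "M (s', t') \<notin> D"
      then have "(s', t') \<in> Z"
        using that st \<open>0 \<le> t'\<close> \<open>t' \<le> 1\<close> interior_subset by (auto simp: Z_def)
      then show False using q(2) that by (fastforce simp: s_def)
    qed
    then have "(\<lambda>s'. M (s', t')) ` {0..<s} \<subseteq> D" by auto
    moreover have "continuous_on (closure {0..<s}) (\<lambda>s'. M (s', t'))"
      by (rule continuous_on_compose2[OF contM]) (auto intro!: continuous_intros)
    ultimately have "(\<lambda>s'. M (s', t')) ` closure {0..<s} \<subseteq> D"
      using assms(1) by (intro image_closure_subset)
    then show ?thesis
      using \<open>s > 0\<close> by (auto simp: image_subset_iff)
  qed
  \<comment> \<open>At scale 1 the original segment would lie in D, contrary to the choice of
    \<open>t0\<close>. Below scale 1 the endpoints are interior by \<open>shrink\<close>, so the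
    touching parameter \<open>t\<close> is neither 0 nor 1.\<close>
  have "s < 1"
    using inD[OF t0(1,2)] t0(3) st by (cases "s = 1") (auto simp: M_def)
  then have "t \<noteq> 0" "t \<noteq> 1"
    using notin shrink xy st by (auto simp: M_def)
  with st have t: "0 < t" "t < 1" by auto
  have "x \<noteq> y"
    using t0 xy by (auto simp: algebra_simps)
  obtain a where a: "\<bar>a\<bar> < min t (1 - t)" "M (s, t) + a *\<^sub>R (s *\<^sub>R (y - x)) \<notin> D"
    using strict[OF inD notin, of "s *\<^sub>R (y - x)" "min t (1 - t)"] st t \<open>x \<noteq> y\<close> \<open>s > 0\<close> by auto
  moreover have "M (s, t) + a *\<^sub>R (s *\<^sub>R (y - x)) = M (s, t + a)"
    by (simp add: M_def algebra_simps)
  moreover have "0 \<le> t + a" "t + a \<le> 1"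
    using a(1) by auto
  ultimately show False using inD[of "t + a"] by simp
qed

text \<open>The parameters t \<ge> 0 for which the multiple of \<open>x\<close> lies in K form a
  compact set, which star-shapedness makes an interval from 0 to some R. The least dilation factor
  in \<open>minkowski_functional\<close> is then 1 / R.\<close>

lemma star_body_radial_function:
  fixes K :: "'a::euclidean_space set"
  assumes "star_body K" "x \<noteq> 0"
  shows "radial_function K x > 0"
    and "\<And>t. t \<ge> 0 \<Longrightarrow> t *\<^sub>R x \<in> K \<longleftrightarrow> t \<le> radial_function K x"
proof -
  define T where "T = {0..} \<inter> (\<lambda>t. t *\<^sub>R x) -` K"
  have K: "compact K" "0 \<in> interior K" "\<And>x. x \<in> K \<Longrightarrow> closed_segment 0 x \<subseteq> K"
    using assms(1) by (auto simp: star_body_def)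
  obtain e where e: "e > 0" "ball 0 e \<subseteq> K"
    using K(2) mem_interior by blast
  obtain B where B: "\<And>y. y \<in> K \<Longrightarrow> norm y \<le> B"
    using compact_imp_bounded[OF K(1)] unfolding bounded_iff by blast
  have "closed T"
    unfolding T_def by (intro closed_Int closed_atLeast closed_vimage compact_imp_closed K(1) continuous_intros)
  moreover have "T \<subseteq> {0..B / norm x}"
    using assms(2) by (auto simp: T_def field_simps dest!: B)
  ultimately have "compact T"
    by (meson bounded_subset bounded_closed_interval compact_eq_bounded_closed)
  \<comment> \<open>A point of the ray strictly inside the ball around 0; it makes \<open>T\<close>
    nonempty and R positive.\<close>
  moreover have eT: "e / (2 * norm x) \<in> T"
    using e assms(2) by (auto simp: T_def subset_iff)
  ultimately obtain R where R: "R \<in> T" "\<And>t. t \<in> T \<Longrightarrow> t \<le> R"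
    using compact_attains_sup[of T] by blast
  have "0 < e / (2 * norm x)" using e assms(2) by simp
  also have "\<dots> \<le> R" using R(2) eT .
  finally have R0: "R > 0" .
  have iff: "t *\<^sub>R x \<in> K \<longleftrightarrow> t \<le> R" if "t \<ge> 0" for t
  proof
    show "t \<le> R" if "t *\<^sub>R x \<in> K"
      using R(2)[of t] that \<open>t \<ge> 0\<close> by (simp add: T_def)
    show "t *\<^sub>R x \<in> K" if "t \<le> R"
    proof -
      have "t *\<^sub>R x = (t / R) *\<^sub>R (R *\<^sub>R x)" using R0 by simp
      then have "t *\<^sub>R x \<in> closed_segment 0 (R *\<^sub>R x)"
        using R0 \<open>t \<ge> 0\<close> that unfolding in_segment by (intro exI[of _ "t / R"]) auto
      then show ?thesis using K(3)[of "R *\<^sub>R x"] R(1) by (auto simp: T_def)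
    qed
  qed
  have "minkowski_functional K x = inverse R"
    unfolding minkowski_functional_def
  proof (rule Least_equality)
    show "0 < inverse R \<and> x \<in> (\<lambda>y. inverse R *\<^sub>R y) ` K"
      using R0 iff[of R] by (auto intro!: image_eqI[of _ _ "R *\<^sub>R x"])
    show "inverse R \<le> a" if a: "0 < a \<and> x \<in> (\<lambda>y. a *\<^sub>R y) ` K" for a
    proof -
      obtain y where "y \<in> K" "x = a *\<^sub>R y" using a by blast
      then have "inverse a *\<^sub>R x \<in> K" using a by simp
      then have "inverse a \<le> R" using iff[of "inverse a"] a by simp
      then show ?thesis using R0 a by (metis inverse_inverse_eq le_imp_inverse_le positive_imp_inverse_positive)
    qed
  qed
  then have "radial_function K x = R" by (simp add: radial_function_def)
  then show "radial_function K x > 0" "\<And>t. t \<ge> 0 \<Longrightarrow> t *\<^sub>R x \<in> K \<longleftrightarrow> t \<le> radial_function K x"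
    using R0 iff by auto
qed

lemma star_body_mem_iff:
  assumes "star_body K"
  shows "y \<in> K \<longleftrightarrow> y = 0 \<or> norm y \<le> radial_function K (sgn y)"
proof (cases "y = 0")
  case True
  then show ?thesis using assms interior_subset by (auto simp: star_body_def)
next
  case False
  then have "sgn y \<noteq> 0" "norm y *\<^sub>R sgn y = y"
    by (auto simp: sgn_div_norm)
  then show ?thesis
    using star_body_radial_function(2)[OF assms, of "sgn y" "norm y"] False by auto
qed

section \<open>The gauge of a smooth convex body\<close>

text \<open>At the origin the minimum defining the Minkowski functional does not exist. The value 0
  there makes homogeneity and subadditivity hold without exceptions.\<close>

definition body_gauge :: "'a::euclidean_space set \<Rightarrow> 'a \<Rightarrow> real" where
  "body_gauge K x = (if x = 0 then 0 else inverse (radial_function K x))"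

locale convex_body_around_origin =
  fixes L :: "'a::euclidean_space set"
  assumes compact: "compact L" and convex: "convex L" and zero_interior: "0 \<in> interior L"
begin

abbreviation "h \<equiv> body_gauge L"

lemma star_body: "star_body L"
  unfolding star_body_def using compact convex zero_interior
  by (metis closed_segment_subset interior_subset subset_iff)

lemma h_0 [simp]: "h 0 = 0"
  by (simp add: body_gauge_def)

lemma h_pos: "x \<noteq> 0 \<Longrightarrow> h x > 0"
  using star_body_radial_function(1)[OF star_body] by (simp add: body_gauge_def)

lemma scaleR_mem_iff: "t \<ge> 0 \<Longrightarrow> t *\<^sub>R x \<in> L \<longleftrightarrow> t * h x \<le> 1"
  using star_body_radial_function[OF star_body, of x] zero_interior interior_subset
  by (cases "x = 0") (auto simp: body_gauge_def field_simps)

lemma mem_iff: "x \<in> L \<longleftrightarrow> h x \<le> 1"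
  using scaleR_mem_iff[of 1 x] by simp

lemma h_scaleR:
  assumes "t \<ge> 0"
  shows "h (t *\<^sub>R x) = t * h x"
proof (cases "t = 0 \<or> x = 0")
  case False
  then have t: "t > 0" "x \<noteq> 0" "t *\<^sub>R x \<noteq> 0" using assms by auto
  have iff: "s * h (t *\<^sub>R x) \<le> 1 \<longleftrightarrow> s * t * h x \<le> 1" if "s \<ge> 0" for s
    using scaleR_mem_iff[of s "t *\<^sub>R x"] scaleR_mem_iff[of "s * t" x] that t by simp
  have "h (t *\<^sub>R x) \<ge> t * h x"
    using iff[of "inverse (h (t *\<^sub>R x))"] h_pos[OF t(3)] by (simp add: field_simps)
  moreover have "h (t *\<^sub>R x) \<le> t * h x"
    using iff[of "inverse (t * h x)"] h_pos[OF t(2)] t by (simp add: field_simps)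
  ultimately show ?thesis by simp
qed auto

lemma h_normalize: "x \<noteq> 0 \<Longrightarrow> h (x /\<^sub>R h x) = 1"
  using h_pos[of x] by (simp add: h_scaleR)

text \<open>Both vectors, divided by their gauge, lie in L. The convex combination with weights
  proportional to \<open>h x\<close> and \<open>h y\<close> is the sum divided by
  \<open>h x + h y\<close>.\<close>

lemma h_triangle: "h (x + y) \<le> h x + h y"
proof (cases "x = 0 \<or> y = 0")
  case False
  then have pos: "h x > 0" "h y > 0" using h_pos by auto
  define s where "s = h x + h y"
  have s: "s > 0" using pos by (simp add: s_def)
  have "x /\<^sub>R h x \<in> L" "y /\<^sub>R h y \<in> L"
    using False by (auto simp: mem_iff h_normalize)
  then have "(h x / s) *\<^sub>R (x /\<^sub>R h x) + (h y / s) *\<^sub>R (y /\<^sub>R h y) \<in> L"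
    using pos s by (intro convexD[OF convex]) (auto simp: s_def add_divide_distrib[symmetric])
  also have "(h x / s) *\<^sub>R (x /\<^sub>R h x) + (h y / s) *\<^sub>R (y /\<^sub>R h y) = inverse s *\<^sub>R (x + y)"
    using pos by (simp add: algebra_simps divide_inverse)
  finally have "inverse s * h (x + y) \<le> 1"
    using s by (simp add: scaleR_mem_iff)
  then show ?thesis using s by (simp add: s_def field_simps)
qed auto

text \<open>Subadditivity bounds the difference by the gauge of \<open>x - y\<close>, and a ball of
  radius \<open>e\<close> inside L bounds the gauge by the norm divided by \<open>e\<close>.\<close>

lemma h_lipschitz: obtains C where "C > 0" "\<And>x y. \<bar>h x - h y\<bar> \<le> C * norm (x - y)"
proof -
  obtain e where e: "e > 0" "cball 0 e \<subseteq> L"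
    using zero_interior mem_interior_cball by blast
  have bd: "h x \<le> inverse e * norm x" for x
  proof (cases "x = 0")
    case False
    then have "(e / norm x) *\<^sub>R x \<in> L" using e by (auto simp: subset_iff)
    then have "e / norm x * h x \<le> 1" using scaleR_mem_iff[of "e / norm x" x] e by simp
    then show ?thesis using False e by (simp add: field_simps)
  qed auto
  have le: "h x - h y \<le> inverse e * norm (x - y)" for x y
    using h_triangle[of y "x - y"] bd[of "x - y"] by simp
  have "\<bar>h x - h y\<bar> \<le> inverse e * norm (x - y)" for x y
    using le[of x y] le[of y x] by (simp add: abs_le_iff norm_minus_commute)
  then show thesis
    using that[of "inverse e"] e(1) by simp
qed

lemma continuous_on_h: "continuous_on S h"
proof -
  obtain C where "C > 0" "\<And>x y. \<bar>h x - h y\<bar> \<le> C * norm (x - y)"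
    by (rule h_lipschitz) blast
  then have "C-lipschitz_on S h"
    by (intro lipschitz_onI) (auto simp: dist_norm)
  then show ?thesis by (rule lipschitz_on_continuous_on)
qed

text \<open>An interior point can be moved outwards along its ray without leaving L, so its gauge is
  strictly below 1; conversely the set where \<open>h\<close> is below 1 is open.\<close>

lemma frontier_iff: "x \<in> frontier L \<longleftrightarrow> h x = 1"
proof -
  have "open {x. h x < 1}"
    by (intro open_Collect_less continuous_on_h continuous_on_const)
  then have "{x. h x < 1} \<subseteq> interior L"
    by (intro interior_maximal) (auto simp: mem_iff)
  moreover have "h x < 1" if x: "x \<in> interior L" for x
  proof (cases "x = 0")
    case False
    obtain e where e: "e > 0" "cball x e \<subseteq> L"
      using x mem_interior_cball by blast
    have "x + (e / norm x) *\<^sub>R x \<in> L"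
      using e False by (auto simp: subset_iff dist_norm)
    then have "(1 + e / norm x) *\<^sub>R x \<in> L"
      by (simp add: algebra_simps)
    then have "(1 + e / norm x) * h x \<le> 1"
      using e False by (subst (asm) scaleR_mem_iff) auto
    moreover have "e / norm x * h x > 0"
      using e False h_pos by auto
    ultimately show ?thesis by (simp add: algebra_simps)
  qed auto
  ultimately have "interior L = {x. h x < 1}"
    by blast
  then show ?thesis
    using compact_imp_closed[OF compact] by (auto simp: frontier_def mem_iff)
qed

text \<open>A hyperplane separates \<open>q\<close> from the interior of L. The inequality extends
  to all of L because \<open>t *\<^sub>R y\<close> is interior for \<open>y\<close> in L and t
  strictly between 0 and 1.\<close>

lemma supporting_normal_exists:
  assumes "h q = 1"
  obtains u where "norm u = 1" "\<And>y. y \<in> L \<Longrightarrow> u \<bullet> (y - q) \<le> 0"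
proof -
  have "q \<notin> interior L"
    using assms frontier_iff[of q] by (auto simp: frontier_def)
  then obtain a b where ab: "a \<noteq> 0" "\<And>x. x \<in> interior L \<Longrightarrow> a \<bullet> x \<le> b" "b \<le> a \<bullet> q"
    using separating_hyperplane_sets[of "interior L" "{q}"] convex_interior[OF convex] zero_interior by auto
  have "b \<ge> 0" using ab(2)[OF zero_interior] by simp
  show thesis
  proof (rule that[of "sgn a"])
    show "norm (sgn a) = 1" using ab by (simp add: norm_sgn)
    fix y assume "y \<in> L"
    have "a \<bullet> y \<le> a \<bullet> q"
    proof (rule field_le_mult_one_interval)
      fix t :: real assume t: "0 < t" "t < 1"
      have "y - (1 - t) *\<^sub>R (y - 0) \<in> interior L"
        by (rule mem_interior_convex_shrink[OF convex zero_interior \<open>y \<in> L\<close>]) (use t in auto)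
      then have "t *\<^sub>R y \<in> interior L"
        by (simp add: algebra_simps)
      then show "t * (a \<bullet> y) \<le> a \<bullet> q" using ab(2)[of "t *\<^sub>R y"] ab(3) by simp
    qed
    then show "sgn a \<bullet> (y - q) \<le> 0"
      using ab(1) by (simp add: sgn_div_norm inner_diff_right mult_le_0_iff)
  qed
qed

text \<open>Rescaling a unit normal to have value 1 at \<open>q\<close> turns the supporting
  half-space into a linear functional below \<open>h\<close> that agrees with \<open>h\<close> at
  \<open>q\<close>. The rescaling is possible because L contains a ball around 0.\<close>

lemma supporting_functional:
  assumes "h q = 1" "norm u = 1" "\<And>y. y \<in> L \<Longrightarrow> u \<bullet> (y - q) \<le> 0"
  shows "u \<bullet> q > 0" "(u /\<^sub>R (u \<bullet> q)) \<bullet> y \<le> h y" "sgn (u /\<^sub>R (u \<bullet> q)) = u"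
proof -
  obtain e where e: "e > 0" "cball 0 e \<subseteq> L"
    using zero_interior mem_interior_cball by blast
  have "e *\<^sub>R u \<in> L" using e assms(2) by (auto simp: subset_iff)
  then have "u \<bullet> (e *\<^sub>R u - q) \<le> 0" by (rule assms(3))
  moreover have "u \<bullet> u = 1" using assms(2) by (simp add: dot_square_norm)
  ultimately show uq: "u \<bullet> q > 0"
    using e by (simp add: inner_diff_right)
  show "(u /\<^sub>R (u \<bullet> q)) \<bullet> y \<le> h y"
  proof (cases "y = 0")
    case False
    then have "y /\<^sub>R h y \<in> L" by (simp add: mem_iff h_normalize)
    then have "u \<bullet> (y /\<^sub>R h y - q) \<le> 0" by (rule assms(3))
    then show ?thesis
      using uq h_pos[OF False] by (simp add: inner_diff_right field_simps)
  qed auto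
  show "sgn (u /\<^sub>R (u \<bullet> q)) = u"
    using uq assms(2) by (simp add: sgn_div_norm)
qed

lemma obtain_support:
  assumes "h q = 1"
  obtains w where "\<And>y. w \<bullet> y \<le> h y" "w \<bullet> q = 1"
proof -
  obtain u where u: "norm u = 1" "\<And>y. y \<in> L \<Longrightarrow> u \<bullet> (y - q) \<le> 0"
    using supporting_normal_exists[OF assms] by blast
  note * = supporting_functional[OF assms u]
  show thesis
    by (rule that[of "u /\<^sub>R (u \<bullet> q)"]) (use * in auto)
qed

text \<open>If the gradient \<open>G\<close> were tangential, i.e. \<open>\<phi>' p = 0\<close>, then \<open>\<phi>\<close> would take both signs on a short
  segment in direction \<open>G\<close> that lies strictly outside the supporting half-space at \<open>p\<close>.\<close>

lemma defining_function_transversal: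
  assumes "h p = 1" "open U" "p \<in> U" "continuous_on U \<phi>"
    and der: "((\<phi> :: 'a \<Rightarrow> real) has_derivative \<phi>') (at p)" and "\<phi>' \<noteq> (\<lambda>v. 0)"
    and zero: "frontier L \<inter> U = {x \<in> U. \<phi> x = 0}"
  shows "\<phi>' p \<noteq> 0"
proof
  assume "\<phi>' p = 0"
  define G where "G = (\<Sum>i\<in>Basis. \<phi>' i *\<^sub>R i)"
  have G: "\<phi>' v = G \<bullet> v" for v
    using has_derivative_Basis_sum[OF der, of v]
    by (simp add: G_def inner_sum_left inner_commute[of v] mult.commute)
  have "G \<noteq> 0" using G assms(6) by auto
  obtain w where w: "\<And>y. w \<bullet> y \<le> h y" "w \<bullet> p = 1"
    using obtain_support[OF assms(1)] by blast
  \<comment> \<open>Small enough that the functional \<open>w\<close> stays positive on all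
    directions \<open>p + s *\<^sub>R G\<close> with \<open>\<bar>s\<bar> \<le> c\<close>, so that
    moving from \<open>p\<close> along them leaves the half-space.\<close>
  define c where "c = inverse (\<bar>w \<bullet> G\<bar> + 1)"
  have c: "c > 0" by (simp add: c_def add_nonneg_pos)
  have wG: "\<bar>s * (w \<bullet> G)\<bar> < 1" if "\<bar>s\<bar> \<le> c" for s
  proof -
    have "\<bar>s * (w \<bullet> G)\<bar> \<le> c * \<bar>w \<bullet> G\<bar>"
      using that by (simp add: abs_mult mult_right_mono)
    also have "\<dots> < 1" by (simp add: c_def field_simps)
    finally show ?thesis .
  qed
  have "\<phi> p = 0" using assms(1,3) zero frontier_iff by blast
  have line: "((\<lambda>t. \<phi> (p + t *\<^sub>R v)) has_real_derivative G \<bullet> v) (at 0)" for v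
    using has_real_derivative_along_line[of \<phi> \<phi>' p 0 v] der G by simp
  have "G \<bullet> p = 0" using \<open>\<phi>' p = 0\<close> G by simp
  have GG: "G \<bullet> G > 0" using \<open>G \<noteq> 0\<close> by simp
  \<comment> \<open>As \<open>G\<close> is orthogonal to \<open>p\<close>, the function
    \<open>\<phi>\<close> rises to first order along one extreme direction and falls along the
    other.\<close>
  have up: "G \<bullet> (p + c *\<^sub>R G) > 0" and down: "G \<bullet> (p + (- c) *\<^sub>R G) < 0"
    using \<open>G \<bullet> p = 0\<close> GG c by (auto simp: inner_add_right inner_diff_right)
  obtain d1 where d1: "d1 > 0" "\<And>t. 0 < t \<Longrightarrow> t < d1 \<Longrightarrow> \<phi> (p + t *\<^sub>R (p + c *\<^sub>R G)) > 0"
    using DERIV_pos_inc_right[OF line up] \<open>\<phi> p = 0\<close> by auto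
  obtain d2 where d2: "d2 > 0" "\<And>t. 0 < t \<Longrightarrow> t < d2 \<Longrightarrow> \<phi> (p + t *\<^sub>R (p + (- c) *\<^sub>R G)) < 0"
    using DERIV_neg_dec_right[OF line down] \<open>\<phi> p = 0\<close> by auto
  obtain r where r: "r > 0" "ball p r \<subseteq> U" using assms(2,3) openE by blast
  define B where "B = norm p + c * norm G + 1"
  have B: "B > 0" using c by (simp add: B_def add_nonneg_pos)
  define m where "m = min (min d1 d2) (r / B)"
  have m: "m > 0" "m \<le> d1" "m \<le> d2" "m \<le> r / B"
    using d1 d2 r B by (auto simp: m_def)
  define t where "t = m / 2"
  have t: "t > 0" "t < d1" "t < d2" "t < r / B"
    unfolding t_def using m by linarith+
  have inU: "p + t *\<^sub>R (p + s *\<^sub>R G) \<in> U" if "\<bar>s\<bar> \<le> c" for s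
  proof -
    have "norm (p + s *\<^sub>R G) \<le> norm p + \<bar>s\<bar> * norm G"
      using norm_triangle_ineq[of p "s *\<^sub>R G"] by simp
    also have "\<dots> \<le> B" using that mult_right_mono[OF that, of "norm G"] by (simp add: B_def)
    finally have "t * norm (p + s *\<^sub>R G) \<le> t * B" using t by simp
    also have "\<dots> < r" using t B by (simp add: field_simps)
    finally show ?thesis using r t by (auto simp: subset_iff dist_norm)
  qed
  have "continuous_on {-c..c} (\<lambda>s. \<phi> (p + t *\<^sub>R (p + s *\<^sub>R G)))"
    by (rule continuous_on_compose2[OF assms(4)]) (use inU in \<open>auto intro!: continuous_intros\<close>)
  moreover have "\<phi> (p + t *\<^sub>R (p + (- c) *\<^sub>R G)) \<le> 0" "0 \<le> \<phi> (p + t *\<^sub>R (p + c *\<^sub>R G))" "- c \<le> c"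
    using d1(2)[of t] d2(2)[of t] t c by auto
  ultimately obtain s where s: "- c \<le> s" "s \<le> c" "\<phi> (p + t *\<^sub>R (p + s *\<^sub>R G)) = 0"
    using IVT'[of "\<lambda>s. \<phi> (p + t *\<^sub>R (p + s *\<^sub>R G))" "-c" 0 c] by blast
  then have "\<bar>s\<bar> \<le> c" by auto
  then have "h (p + t *\<^sub>R (p + s *\<^sub>R G)) = 1"
    using inU[of s] zero s(3) frontier_iff by blast
  moreover have "w \<bullet> (p + t *\<^sub>R (p + s *\<^sub>R G)) = 1 + t * (1 + s * (w \<bullet> G))"
    using w(2) by (simp add: inner_add_right)
  moreover have "t * (1 + s * (w \<bullet> G)) > 0"
    using t wG[OF \<open>\<bar>s\<bar> \<le> c\<close>] by (intro mult_pos_pos) auto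
  ultimately show False using w(1)[of "p + t *\<^sub>R (p + s *\<^sub>R G)"] by simp
qed

section \<open>Smoothness of the gauge\<close>

text \<open>Implicit differentiation of \<open>\<phi> (y /\<^sub>R h y) = 0\<close>. Continuity of
  \<open>h\<close> brings \<open>y /\<^sub>R h y\<close> close to \<open>p\<close>, and its
  Lipschitz bound turns an error small relative to the distance from \<open>p\<close> into one small
  relative to \<open>norm (y - z)\<close>.\<close>

lemma h_has_derivative:
  assumes "z \<noteq> 0" "open U" "z /\<^sub>R h z \<in> U"
    and der: "((\<phi> :: 'a \<Rightarrow> real) has_derivative \<phi>') (at (z /\<^sub>R h z))" and nz: "\<phi>' (z /\<^sub>R h z) \<noteq> 0"
    and zero: "frontier L \<inter> U = {x \<in> U. \<phi> x = 0}"
  shows "(h has_derivative (\<lambda>v. \<phi>' v / \<phi>' (z /\<^sub>R h z))) (at z)"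
proof -
  define p where "p = z /\<^sub>R h z"
  define a where "a = \<phi>' p"
  have bl: "bounded_linear \<phi>'" using der has_derivative_bounded_linear by blast
  have lin: "linear \<phi>'" using bl by (simp add: bounded_linear.linear)
  have hz: "h z > 0" using assms(1) h_pos by simp
  have z: "z = h z *\<^sub>R p" using hz by (simp add: p_def)
  obtain C where C: "C > 0" "\<And>x y. \<bar>h x - h y\<bar> \<le> C * norm (x - y)"
    by (rule h_lipschitz) blast
  have on_frontier: "\<phi> (y /\<^sub>R h y) = 0" if "y \<noteq> 0" "y /\<^sub>R h y \<in> U" for y
    using h_normalize[OF that(1)] frontier_iff that(2) zero by blast
  have cont: "isCont (\<lambda>y. y /\<^sub>R h y) z"
    using continuous_on_h[of UNIV] hz
    by (intro continuous_intros) (auto simp: continuous_on_eq_continuous_at)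
  show ?thesis
    unfolding p_def[symmetric] a_def[symmetric] has_derivative_at_alt
  proof (intro conjI allI impI)
    show "bounded_linear (\<lambda>v. \<phi>' v / a)"
      using bounded_linear_compose[OF bounded_linear_divide bl] by simp
    fix e :: real assume "e > 0"
    define M where "M = 1 + C * norm p"
    have M: "M > 0" using C by (simp add: M_def add_pos_nonneg)
    define e' where "e' = e * \<bar>a\<bar> / M"
    have e': "e' > 0" using \<open>e > 0\<close> M nz by (simp add: e'_def a_def p_def)
    obtain d1 where d1: "d1 > 0" "\<And>q. norm (q - p) < d1 \<Longrightarrow>
        norm (\<phi> q - \<phi> p - \<phi>' (q - p)) \<le> e' * norm (q - p)"
      using der e' unfolding has_derivative_at_alt p_def by blast
    have "((\<lambda>y. y /\<^sub>R h y) \<longlongrightarrow> p) (nhds z)"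
      using cont tendsto_at_iff_tendsto_nhds[of "\<lambda>y. y /\<^sub>R h y" z] by (simp add: isCont_def p_def)
    then have "eventually (\<lambda>y. y /\<^sub>R h y \<in> ball p d1 \<inter> U) (nhds z)"
      by (rule topological_tendstoD) (use d1(1) assms(2,3) in \<open>auto simp: p_def\<close>)
    then obtain d2 where d2: "d2 > 0" "\<And>y. dist y z < d2 \<Longrightarrow> y /\<^sub>R h y \<in> ball p d1 \<inter> U"
      unfolding eventually_nhds_metric by blast
    show "\<exists>d>0. \<forall>y. norm (y - z) < d \<longrightarrow> norm (h y - h z - \<phi>' (y - z) / a) \<le> e * norm (y - z)"
    proof (intro exI[of _ "min d2 (norm z)"] conjI allI impI)
      show "min d2 (norm z) > 0" using d2 assms(1) by simp
      fix y assume y: "norm (y - z) < min d2 (norm z)"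
      then have "y \<noteq> 0" by auto
      define q where "q = y /\<^sub>R h y"
      have hy: "h y > 0" using \<open>y \<noteq> 0\<close> h_pos by simp
      have q: "norm (q - p) < d1" "q \<in> U"
        using d2(2)[of y] y by (auto simp: q_def dist_norm norm_minus_commute)
      have "\<phi> q = 0" "\<phi> p = 0"
        using on_frontier[of y] on_frontier[of z] \<open>y \<noteq> 0\<close> assms(1,3) q(2) by (auto simp: q_def p_def)
      then have bound: "\<bar>\<phi>' (q - p)\<bar> \<le> e' * norm (q - p)" using d1(2)[OF q(1)] by simp
      \<comment> \<open>Applying \<open>\<phi>'\<close> to this identity produces
        \<open>\<phi>' (y - z) - (h y - h z) * a\<close>, the very quantity that has to be
        small.\<close>
      have yq: "h y *\<^sub>R (q - p) = (y - z) - (h y - h z) *\<^sub>R p"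
        using hy z by (simp add: q_def algebra_simps)
      have "norm (h y *\<^sub>R (q - p)) \<le> norm (y - z) + \<bar>h y - h z\<bar> * norm p"
        unfolding yq using norm_triangle_ineq4[of "y - z" "(h y - h z) *\<^sub>R p"] by simp
      also have "\<dots> \<le> norm (y - z) + (C * norm (y - z)) * norm p"
        using C(2) by (intro add_left_mono mult_right_mono) auto
      also have "\<dots> = M * norm (y - z)" by (simp add: M_def algebra_simps)
      finally have n: "norm (h y *\<^sub>R (q - p)) \<le> M * norm (y - z)" .
      have "\<phi>' (h y *\<^sub>R (q - p)) = \<phi>' (y - z) - (h y - h z) * a"
        unfolding yq a_def by (simp add: linear_diff[OF lin] linear_scale[OF lin])
      then have "\<bar>\<phi>' (y - z) - (h y - h z) * a\<bar> = h y * \<bar>\<phi>' (q - p)\<bar>"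
        using hy by (metis abs_mult abs_of_pos linear_scale[OF lin] real_scaleR_def)
      also have "\<dots> \<le> h y * (e' * norm (q - p))"
        using bound hy by simp
      also have "\<dots> = e' * norm (h y *\<^sub>R (q - p))" using hy by simp
      also have "\<dots> \<le> e' * (M * norm (y - z))" using n e' by simp
      also have "\<dots> = e * \<bar>a\<bar> * norm (y - z)" using M by (simp add: e'_def)
      finally have le: "\<bar>\<phi>' (y - z) - (h y - h z) * a\<bar> \<le> e * \<bar>a\<bar> * norm (y - z)" .
      have a: "\<bar>a\<bar> > 0" using nz by (simp add: a_def p_def)
      have "h y - h z - \<phi>' (y - z) / a = - (\<phi>' (y - z) - (h y - h z) * a) / a"
        using a by (simp add: field_simps)
      then have "norm (h y - h z - \<phi>' (y - z) / a) = \<bar>\<phi>' (y - z) - (h y - h z) * a\<bar> / \<bar>a\<bar>"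
        by (simp add: abs_divide abs_minus_commute)
      also have "\<dots> \<le> e * norm (y - z)"
        using le a by (simp add: field_simps)
      finally show "norm (h y - h z - \<phi>' (y - z) / a) \<le> e * norm (y - z)" .
    qed
  qed
qed

text \<open>The formula for the derivative of \<open>h\<close> contains \<open>h\<close> only
  through the point \<open>y /\<^sub>R h y\<close> and no derivative of \<open>h\<close>, so if
  \<open>h\<close> is of class \<open>C\<^sup>k\<close> then so is its derivative.\<close>

lemma Ck_on_h:
  assumes "smooth_hypersurface (frontier L)"
  shows "Ck_on k h (- {0})"
proof (induction k)
  case 0
  then show ?case by (simp add: continuous_on_h)
next
  case (Suc k)
  show ?case
  proof (rule Ck_on_local)
    fix z :: 'a assume "z \<in> - {0}"
    then have z: "z \<noteq> 0" by simp
    have "z /\<^sub>R h z \<in> frontier L" using h_normalize[OF z] frontier_iff by blast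
    from bspec[OF assms[unfolded smooth_hypersurface_def] this]
    obtain U \<phi> where U: "open U" "z /\<^sub>R h z \<in> U" and \<phi>': "\<forall>k. Ck_on k \<phi> U"
      and nz: "\<forall>x\<in>U. frechet_derivative \<phi> (at x) \<noteq> (\<lambda>v. 0)"
      and zero: "frontier L \<inter> U = {x \<in> U. \<phi> x = 0}"
      by blast
    have \<phi>: "Ck_on k \<phi> U" for k using \<phi>' by blast
    let ?q = "\<lambda>y. y /\<^sub>R h y"
    define V where "V = (- {0}) \<inter> ?q -` U"
    have "continuous_on (- {0}) ?q"
      by (intro continuous_intros continuous_on_h) (use h_pos in force)
    then have "open V"
      unfolding V_def by (rule continuous_open_preimage) (use U in auto)
    have V: "y \<noteq> 0" "?q y \<in> U" if "y \<in> V" for y using that by (auto simp: V_def)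
    have der: "(\<phi> has_derivative frechet_derivative \<phi> (at (?q y))) (at (?q y))" if "y \<in> V" for y
      using Ck_on_SucD(1)[OF \<phi> V(2)[OF that]] .
    have trans: "frechet_derivative \<phi> (at (?q y)) (?q y) \<noteq> 0" if "y \<in> V" for y
      using V[OF that] U(1) Ck_on_imp_continuous_on[OF \<phi>] der[OF that] nz zero
      by (intro defining_function_transversal[OF h_normalize]) auto
    have qC: "Ck_on k (\<lambda>y. ?q y \<bullet> i) V" for i
    proof -
      have "Ck_on k (\<lambda>y. (y \<bullet> i) / h y) V"
      proof (rule Ck_on_divide[OF \<open>open V\<close>])
        show "h y \<noteq> 0" if "y \<in> V" for y using h_pos[OF V(1)[OF that]] by simp
        show "Ck_on k (\<lambda>y. y \<bullet> i) V"
          using \<open>open V\<close> bounded_linear_inner_left by (rule Ck_on_bounded_linear)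
        show "Ck_on k h V" by (rule Ck_on_subset[OF Suc.IH]) (auto simp: V_def)
      qed
      then show ?thesis by (simp add: field_simps)
    qed
    have phiC: "Ck_on k (\<lambda>y. frechet_derivative \<phi> (at (?q y)) b) V" if "b \<in> Basis" for b
      by (rule Ck_on_compose[OF \<open>open V\<close> U(1) _ Ck_on_SucD(2)[OF \<phi> that] qC]) (use V in auto)
    have "Ck_on (Suc k) h V"
    proof (rule Ck_on_SucI[OF \<open>open V\<close>])
      show "(h has_derivative (\<lambda>v. frechet_derivative \<phi> (at (?q y)) v
          / frechet_derivative \<phi> (at (?q y)) (?q y))) (at y)" if "y \<in> V" for y
        using V[OF that] U(1) der[OF that] trans[OF that] zero by (intro h_has_derivative) auto
      fix b :: 'a assume "b \<in> Basis"
      \<comment> \<open>The denominator is expanded in the basis since regularity is available for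
        partial derivatives in fixed basis directions, whereas here the direction varies with
        \<open>y\<close>.\<close>
      have "Ck_on k (\<lambda>y. frechet_derivative \<phi> (at (?q y)) b /
          (\<Sum>j\<in>Basis. (?q y \<bullet> j) * frechet_derivative \<phi> (at (?q y)) j)) V"
      proof (intro Ck_on_divide[OF \<open>open V\<close>] Ck_on_sum Ck_on_mult \<open>open V\<close> phiC \<open>b \<in> Basis\<close> qC)
        show "(\<Sum>j\<in>Basis. (?q y \<bullet> j) * frechet_derivative \<phi> (at (?q y)) j) \<noteq> 0" if "y \<in> V" for y
          using trans[OF that] has_derivative_Basis_sum[OF der[OF that], of "?q y"]
          unfolding real_scaleR_def by argo
      qed
      then show "Ck_on k (\<lambda>y. frechet_derivative \<phi> (at (?q y)) b / frechet_derivative \<phi> (at (?q y)) (?q y)) V"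
        by (rule Ck_on_cong[OF \<open>open V\<close>, rotated])
          (simp only: has_derivative_Basis_sum[OF der, symmetric, unfolded real_scaleR_def])
    qed
    then show "\<exists>U. open U \<and> z \<in> U \<and> Ck_on (Suc k) h U"
      using \<open>open V\<close> z U(2) by (intro exI[of _ V]) (auto simp: V_def)
  qed
qed

end

section \<open>Gradient and Hessian of the gauge\<close>

lemma open_Compl_singleton: "open (- {x :: 'a::t1_space})"
  by (simp add: open_Compl)

lemma dir_deriv2_add_scaleR:
  "dir_deriv2 f x (v + t *\<^sub>R w) (v + t *\<^sub>R w) =
     dir_deriv2 f x v v + t * (dir_deriv2 f x v w + dir_deriv2 f x w v) + t\<^sup>2 * dir_deriv2 f x w w"
proof -
  have left: "dir_deriv2 f x (a + t *\<^sub>R b) c = dir_deriv2 f x a c + t * dir_deriv2 f x b c" for a b c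
    by (simp add: dir_deriv2_def inner_add_left sum.distrib sum_distrib_left algebra_simps)
  have right: "dir_deriv2 f x c (a + t *\<^sub>R b) = dir_deriv2 f x c a + t * dir_deriv2 f x c b" for a b c
    by (simp add: dir_deriv2_def inner_add_left sum.distrib sum_distrib_left algebra_simps)
  show ?thesis
    by (simp add: left right power2_eq_square algebra_simps)
qed

locale smooth_convex_body = convex_body_around_origin +
  assumes smooth: "smooth_hypersurface (frontier L)"
begin

lemma C2_h: "Ck_on 2 h (- {0})"
  using Ck_on_h[OF smooth] .

definition grad_h :: "'a \<Rightarrow> 'a" where
  "grad_h z = (\<Sum>i\<in>Basis. frechet_derivative h (at z) i *\<^sub>R i)"

lemma h_derivative: "z \<noteq> 0 \<Longrightarrow> (h has_derivative frechet_derivative h (at z)) (at z)"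
  using Ck_on_2D(1)[OF C2_h, of z] by simp

lemma frechet_derivative_h: "z \<noteq> 0 \<Longrightarrow> frechet_derivative h (at z) v = grad_h z \<bullet> v"
  using has_derivative_Basis_sum[OF h_derivative, of z v]
  by (simp add: grad_h_def inner_sum_left inner_commute[of v] mult.commute)

text \<open>The difference \<open>h y - w \<bullet> y\<close> is nonnegative and vanishes at
  \<open>z\<close>, so its derivative vanishes there.\<close>

lemma supporting_functional_eq_grad:
  assumes "z \<noteq> 0" "\<And>y. w \<bullet> y \<le> h y" "w \<bullet> z = h z"
  shows "w = grad_h z"
proof -
  have "((\<lambda>y. h y - w \<bullet> y) has_derivative (\<lambda>v. frechet_derivative h (at z) v - w \<bullet> v)) (at z)"
    by (intro has_derivative_diff h_derivative assms(1) has_derivative_inner_right has_derivative_ident)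
  then have "(\<lambda>v. frechet_derivative h (at z) v - w \<bullet> v) = (\<lambda>v. 0)"
    by (rule has_derivative_local_min) (use assms in simp)
  then have "\<forall>v. w \<bullet> v = grad_h z \<bullet> v"
    using frechet_derivative_h[OF assms(1)] by (metis eq_iff_diff_eq_0)
  then show ?thesis by (simp add: vector_eq_rdot)
qed

lemma grad_h_support:
  assumes "z \<noteq> 0"
  shows "grad_h z \<bullet> y \<le> h y" "grad_h z \<bullet> z = h z"
proof -
  obtain w where w: "\<And>y. w \<bullet> y \<le> h y" "w \<bullet> (z /\<^sub>R h z) = 1"
    using obtain_support[OF h_normalize[OF assms]] by blast
  then have wz: "w \<bullet> z = h z" using h_pos[OF assms] by (simp add: field_simps)
  then have "w = grad_h z" using assms w(1) by (intro supporting_functional_eq_grad)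
  then show "grad_h z \<bullet> y \<le> h y" "grad_h z \<bullet> z = h z" using w(1) wz by auto
qed

lemma grad_h_nonzero: "z \<noteq> 0 \<Longrightarrow> grad_h z \<noteq> 0"
  using grad_h_support(2)[of z] h_pos[of z] by auto

text \<open>Every outer unit normal, rescaled, is a supporting functional and hence the gradient.
  This settles uniqueness, and existence of some normal then shows that the normalised gradient is
  one. The Gauss map thereby becomes computable from derivatives of \<open>h\<close>.\<close>

lemma outer_unit_normal_eq:
  assumes "z \<noteq> 0"
  shows "outer_unit_normal L (z /\<^sub>R h z) = sgn (grad_h z)"
  unfolding outer_unit_normal_def
proof (rule the_equality)
  let ?q = "z /\<^sub>R h z"
  have hq: "h ?q = 1" using h_normalize[OF assms] .
  have unique: "u = sgn (grad_h z)" if u: "norm u = 1 \<and> (\<forall>y\<in>L. u \<bullet> (y - ?q) \<le> 0)" for u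
  proof -
    have u': "norm u = 1" "\<And>y. y \<in> L \<Longrightarrow> u \<bullet> (y - ?q) \<le> 0" using u by auto
    note sf = supporting_functional[OF hq u']
    have "(u /\<^sub>R (u \<bullet> ?q)) \<bullet> z = h z"
      using sf(1) h_pos[OF assms] by (simp add: field_simps)
    then have "u /\<^sub>R (u \<bullet> ?q) = grad_h z"
      using sf(2) assms by (intro supporting_functional_eq_grad)
    then show ?thesis using sf(3) by simp
  qed
  then show "u = sgn (grad_h z)" if "norm u = 1 \<and> (\<forall>y\<in>L. u \<bullet> (y - ?q) \<le> 0)" for u
    using that .
  obtain u where "norm u = 1" "\<And>y. y \<in> L \<Longrightarrow> u \<bullet> (y - ?q) \<le> 0"
    using supporting_normal_exists[OF hq] by blast
  then show "norm (sgn (grad_h z)) = 1 \<and> (\<forall>y\<in>L. sgn (grad_h z) \<bullet> (y - ?q) \<le> 0)"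
    using unique by blast
qed

lemma line_avoids_origin:
  fixes z v :: 'a
  assumes "z \<noteq> 0"
  obtains d where "d > 0" "\<And>s. \<bar>s\<bar> < d \<Longrightarrow> z + s *\<^sub>R v \<noteq> 0"
proof -
  have "open ((\<lambda>s. z + s *\<^sub>R v) -` (- {0}))"
    by (intro open_vimage continuous_intros open_Compl_singleton)
  moreover have "0 \<in> (\<lambda>s. z + s *\<^sub>R v) -` (- {0})" using assms by simp
  ultimately obtain d where "d > 0" "ball 0 d \<subseteq> (\<lambda>s. z + s *\<^sub>R v) -` (- {0})"
    using openE by blast
  then show thesis using that[of d] by (auto simp: subset_iff dist_norm)
qed

text \<open>The gradient functional lies below \<open>h\<close> and touches it at \<open>z\<close>,
  so functional minus \<open>h\<close> is maximal at \<open>z\<close> on every line through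
  \<open>z\<close>.\<close>

lemma dir_deriv2_h_nonneg:
  assumes "z \<noteq> 0"
  shows "dir_deriv2 h z v v \<ge> 0"
proof -
  obtain d where d: "d > 0" "\<And>s. \<bar>s\<bar> < d \<Longrightarrow> z + s *\<^sub>R v \<noteq> 0"
    using line_avoids_origin[OF assms, of v] by blast
  let ?f = "\<lambda>s. grad_h z \<bullet> (z + s *\<^sub>R v) - h (z + s *\<^sub>R v)"
  have "- dir_deriv2 h z v v \<le> 0"
  proof (rule second_derivative_le_0_at_local_max[OF d(1)])
    show "(?f has_real_derivative grad_h z \<bullet> v - frechet_derivative h (at (z + s *\<^sub>R v)) v) (at s)"
      if "\<bar>s\<bar> < d" for s
    proof (rule DERIV_diff)
      show "((\<lambda>s. grad_h z \<bullet> (z + s *\<^sub>R v)) has_real_derivative grad_h z \<bullet> v) (at s)"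
        by (rule has_real_derivative_along_line)
          (intro has_derivative_inner_right has_derivative_ident)
      show "((\<lambda>s. h (z + s *\<^sub>R v)) has_real_derivative frechet_derivative h (at (z + s *\<^sub>R v)) v) (at s)"
        by (intro has_real_derivative_along_line h_derivative d(2) that)
    qed
    show "((\<lambda>s. grad_h z \<bullet> v - frechet_derivative h (at (z + s *\<^sub>R v)) v)
        has_real_derivative - dir_deriv2 h z v v) (at 0)"
      using DERIV_diff[OF DERIV_const has_real_derivative_frechet_along_line[OF C2_h open_Compl_singleton, of z 0 v v]] assms
      by simp
    show "?f s \<le> ?f 0" for s
      using grad_h_support[OF assms] by simp
  qed
  then show ?thesis by simp
qed

text \<open>A null vector of a positive semidefinite symmetric form lies in its kernel: otherwise
  the form would be negative at \<open>v + t *\<^sub>R w\<close> for a suitable small t.\<close>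

lemma dir_deriv2_h_kernel:
  assumes "z \<noteq> 0" "dir_deriv2 h z v v = 0"
  shows "dir_deriv2 h z v w = 0"
proof (rule ccontr)
  define b c where "b = dir_deriv2 h z v w" and "c = dir_deriv2 h z w w"
  assume "\<not> ?thesis"
  then have b: "b\<^sup>2 > 0" by (simp add: b_def)
  have c: "c \<ge> 0" using dir_deriv2_h_nonneg[OF assms(1)] by (simp add: c_def)
  have sym: "dir_deriv2 h z w v = b"
    using dir_deriv2_commute[OF C2_h open_Compl_singleton, of z w v] assms(1) by (simp add: b_def)
  \<comment> \<open>The minimiser would be \<open>- b / c\<close>; the summand 1 covers
    \<open>c = 0\<close> as well.\<close>
  define t where "t = - b / (c + 1)"
  have "0 \<le> dir_deriv2 h z (v + t *\<^sub>R w) (v + t *\<^sub>R w)"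
    using dir_deriv2_h_nonneg[OF assms(1)] .
  also have "\<dots> = t * (2 * b) + t\<^sup>2 * c"
    using assms(2) sym by (simp add: dir_deriv2_add_scaleR b_def c_def)
  also have "\<dots> = - (b\<^sup>2 * (c + 2) / (c + 1)\<^sup>2)"
    using c by (simp add: t_def field_simps power2_eq_square add_nonneg_eq_0_iff)
  also have "\<dots> < 0"
    using b c by (simp add: zero_less_mult_iff)
  finally show False by simp
qed

end

section \<open>Positive curvature and the Hessian of the squared gauge\<close>

locale positively_curved_body = smooth_convex_body L for L :: "(real ^ 'n) set" +
  assumes curvature: "\<And>p. p \<in> frontier L \<Longrightarrow> \<exists>\<kappa>>0. has_gaussian_curvature L p \<kappa>"
begin

text \<open>The expression is half the second derivative of the squared gauge along
  \<open>v\<close>. Its summands are nonnegative, so a failure makes both vanish; the derivative of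
  the Gauss map along \<open>v\<close> is then computed in two ways.\<close>

lemma squared_gauge_hessian_pos:
  assumes "z \<noteq> 0" "v \<noteq> 0"
  shows "(frechet_derivative h (at z) v)\<^sup>2 + h z * dir_deriv2 h z v v > 0"
proof (rule ccontr)
  assume neg: "\<not> ?thesis"
  have hz: "h z > 0" using h_pos[OF assms(1)] .
  have "h z * dir_deriv2 h z v v \<ge> 0"
    using dir_deriv2_h_nonneg[OF assms(1)] hz by simp
  then have "(frechet_derivative h (at z) v)\<^sup>2 = 0" "h z * dir_deriv2 h z v v = 0"
    using neg zero_le_power2[of "frechet_derivative h (at z) v"] by linarith+
  then have D1: "frechet_derivative h (at z) v = 0" and D2: "dir_deriv2 h z v v = 0"
    using hz by auto
  define p where "p = z /\<^sub>R h z"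
  have pf: "p \<in> frontier L"
    using h_normalize[OF assms(1)] by (simp add: frontier_iff p_def)
  let ?N = "outer_unit_normal L"
  obtain \<kappa> W where k: "\<kappa> > 0" and W: "(?N has_derivative W) (at p within frontier L)"
    and det: "\<kappa> = det (matrix (\<lambda>v. W (v - (v \<bullet> ?N p) *\<^sub>R ?N p) + (v \<bullet> ?N p) *\<^sub>R ?N p))"
    using curvature[OF pf] unfolding has_gaussian_curvature_def Let_def by blast
  have linW: "linear W" using W has_derivative_linear by blast
  define T where "T = (\<lambda>t. z + t *\<^sub>R v) -` (- {0})"
  have "open T" unfolding T_def by (intro open_vimage continuous_intros open_Compl_singleton)
  have "0 \<in> T" using assms(1) by (simp add: T_def)
  \<comment> \<open>The line projected radially to the frontier, because \<open>W\<close> is a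
    derivative within the frontier only. As \<open>h\<close> is stationary along \<open>v\<close>,
    the velocity of this curve at 0 is \<open>v /\<^sub>R h z\<close>.\<close>
  define c where "c = (\<lambda>t. inverse (h (z + t *\<^sub>R v)) *\<^sub>R (z + t *\<^sub>R v))"
  have c0: "c 0 = p" by (simp add: c_def p_def)
  have "((\<lambda>t. h (z + t *\<^sub>R v)) has_real_derivative 0) (at 0)"
    using has_real_derivative_along_line[of h _ z 0 v] h_derivative[OF assms(1)] D1 by fastforce
  then have hl: "((\<lambda>t. h (z + t *\<^sub>R v)) has_derivative (\<lambda>t. 0)) (at 0)"
    by (simp add: has_field_derivative_def lambda_zero)
  have "((\<lambda>t. inverse (h (z + t *\<^sub>R v))) has_derivative
      (\<lambda>t. - (inverse (h (z + 0 *\<^sub>R v)) * 0 * inverse (h (z + 0 *\<^sub>R v))))) (at 0)"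
    by (rule Deriv.has_derivative_inverse[OF _ hl]) (use hz in simp)
  moreover have "((\<lambda>t. z + t *\<^sub>R v) has_derivative (\<lambda>t. t *\<^sub>R v)) (at 0)"
    by (auto intro!: derivative_eq_intros)
  ultimately have "(c has_derivative (\<lambda>t. inverse (h (z + 0 *\<^sub>R v)) *\<^sub>R (t *\<^sub>R v)
      + (- (inverse (h (z + 0 *\<^sub>R v)) * 0 * inverse (h (z + 0 *\<^sub>R v)))) *\<^sub>R (z + 0 *\<^sub>R v))) (at 0)"
    unfolding c_def by (rule has_derivative_scaleR)
  from has_derivative_at_withinI[OF this, of T]
  have cder: "(c has_derivative (\<lambda>t. t *\<^sub>R (v /\<^sub>R h z))) (at 0 within T)"
    by (simp add: mult.commute)
  have "c ` T \<subseteq> frontier L"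
    by (auto simp: T_def c_def frontier_iff intro!: h_normalize)
  then have "(?N has_derivative W) (at (c 0) within c ` T)"
    unfolding c0 using W by (rule has_derivative_subset[rotated])
  then have "((\<lambda>t. ?N (c t)) has_derivative (\<lambda>t. W (t *\<^sub>R (v /\<^sub>R h z)))) (at 0 within T)"
    using cder by (rule has_derivative_in_compose[rotated])
  then have 1: "((\<lambda>t. ?N (c t)) has_derivative (\<lambda>t. W (t *\<^sub>R (v /\<^sub>R h z)))) (at 0)"
    using at_within_open[OF \<open>0 \<in> T\<close> \<open>open T\<close>] by simp
  \<comment> \<open>The second computation: along the curve the normal is the normalised gradient,
    and the gradient is stationary because \<open>v\<close> lies in the kernel of the
    Hessian.\<close>
  have "((\<lambda>t. frechet_derivative h (at (z + t *\<^sub>R v)) i) has_derivative (\<lambda>t. 0)) (at 0)" for i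
    using has_real_derivative_frechet_along_line[OF C2_h open_Compl_singleton, of z 0 v i] dir_deriv2_h_kernel[OF assms(1) D2, of i] assms(1)
    by (simp add: has_field_derivative_def lambda_zero)
  then have "((\<lambda>t. grad_h (z + t *\<^sub>R v)) has_derivative (\<lambda>t. \<Sum>i\<in>Basis. 0 *\<^sub>R i)) (at 0)"
    unfolding grad_h_def by (intro has_derivative_sum has_derivative_scaleR_left)
  then have gl: "((\<lambda>t. grad_h (z + t *\<^sub>R v)) has_derivative (\<lambda>t. 0)) (at 0)"
    by simp
  have "(\<lambda>x. x /\<^sub>R norm x) differentiable (at (grad_h z))"
    using grad_h_nonzero[OF assms(1)]
    by (intro differentiable_scaleR differentiable_inverse differentiable_norm_at differentiable_ident) auto
  then obtain S where S: "((\<lambda>x. x /\<^sub>R norm x) has_derivative S) (at (grad_h (z + 0 *\<^sub>R v)))"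
    unfolding differentiable_def by auto
  have "S 0 = 0" by (rule linear_0[OF has_derivative_linear[OF S]])
  then have sl: "((\<lambda>t. grad_h (z + t *\<^sub>R v) /\<^sub>R norm (grad_h (z + t *\<^sub>R v))) has_derivative (\<lambda>t. 0)) (at 0)"
    using has_derivative_compose[OF gl S] by simp
  have eq: "grad_h (z + t *\<^sub>R v) /\<^sub>R norm (grad_h (z + t *\<^sub>R v)) = ?N (c t)" if "t \<in> T" for t
    using outer_unit_normal_eq[of "z + t *\<^sub>R v"] that by (simp add: T_def c_def sgn_div_norm)
  have 2: "((\<lambda>t. ?N (c t)) has_derivative (\<lambda>t. 0)) (at 0)"
    using sl \<open>open T\<close> \<open>0 \<in> T\<close> eq by (rule has_derivative_transform_within_open)
  have "W (v /\<^sub>R h z) = 0"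
    using fun_cong[OF has_derivative_unique[OF 1 2], of 1] by simp
  then have Wv: "W v = 0"
    using hz by (simp add: linear_scale[OF linW])
  have "?N p = sgn (grad_h z)" unfolding p_def by (rule outer_unit_normal_eq[OF assms(1)])
  then have vN: "v \<bullet> ?N p = 0"
    using D1 frechet_derivative_h[OF assms(1), of v] by (simp add: sgn_div_norm inner_commute)
  \<comment> \<open>This is the map whose determinant is the curvature. Since \<open>v\<close> is
    orthogonal to the normal, it sends \<open>v\<close> to \<open>W v\<close>, that is, to
    0.\<close>
  define M where "M = (\<lambda>v. W (v - (v \<bullet> ?N p) *\<^sub>R ?N p) + (v \<bullet> ?N p) *\<^sub>R ?N p)"
  have "linear M"
    unfolding M_def
    by (rule linearI) (simp_all add: linear_add[OF linW] linear_diff[OF linW] linear_scale[OF linW]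
        inner_add_left algebra_simps)
  then have "matrix M *v v = M v" by (rule fun_cong[OF matrix_vector_mul(2)])
  then have "matrix M *v v = 0" using Wv vN by (simp add: M_def)
  then have "\<not> invertible (matrix M)"
    using assms(2) by (metis invertible_def matrix_left_invertible_ker)
  then have "det (matrix M) = 0" by (simp add: invertible_det_nz)
  then show False using det k by (simp add: M_def)
qed

end

section \<open>The perturbed body\<close>

lemma Ck_on_snd:
  fixes F :: "'b::euclidean_space \<Rightarrow> real"
  assumes "open S" "Ck_on k F S"
  shows "Ck_on k (\<lambda>p :: 'a::euclidean_space \<times> 'b. F (snd p)) (UNIV \<times> S)"
proof (rule Ck_on_compose[of "UNIV \<times> S" S snd])
  have "bounded_linear (\<lambda>p :: 'a \<times> 'b. snd p \<bullet> i)" for i :: 'b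
    by (rule bounded_linear_compose[OF bounded_linear_inner_left bounded_linear_snd])
  then show "Ck_on k (\<lambda>p :: 'a \<times> 'b. snd p \<bullet> i) (UNIV \<times> S)" for i
    by (intro Ck_on_bounded_linear open_Times open_UNIV assms(1))
qed (use assms in \<open>auto intro: open_Times\<close>)

locale gauge_perturbation = positively_curved_body L for L :: "(real ^ 'n) set" +
  fixes f g :: "real ^ 'n \<Rightarrow> real"
  assumes dim_ge_2: "CARD('n) \<ge> 2"
    and C2_f: "Ck_on 2 f (- {0})" and C2_g: "Ck_on 2 g (- {0})"
    and f_pos: "\<And>x. x \<noteq> 0 \<Longrightarrow> f x > 0"
    and f_integrable: "\<And>x R. x \<in> sphere 0 1 \<Longrightarrow> R > 0 \<Longrightarrow>
           (\<lambda>t. t ^ (CARD('n) - 2) * f (t *\<^sub>R x)) integrable_on {0..R}"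
begin

section \<open>Radial integrals and the defining equation\<close>

abbreviation (input) "ray_density x t \<equiv> t ^ (CARD('n) - 2) * f (t *\<^sub>R x)"

lemma continuous_on_ray_density:
  assumes "x \<noteq> 0"
  shows "continuous_on {0<..} (ray_density x)"
proof -
  have "continuous_on {0<..} (\<lambda>t. f (t *\<^sub>R x))"
    by (rule continuous_on_compose2[OF Ck_on_imp_continuous_on[OF C2_f]])
      (use assms in \<open>auto intro!: continuous_intros\<close>)
  then show ?thesis by (intro continuous_intros)
qed

text \<open>The density need not be bounded near 0, so the fundamental theorem is used in the form
  for an integrable function continuous at one point. Integrating up to \<open>t + 1\<close> puts
  \<open>t\<close> inside the interval.\<close>

lemma radial_integral_derivative:
  assumes "x \<in> sphere 0 1" "t > 0"
  shows "(radial_integral f x has_real_derivative ray_density x t) (at t)"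
proof -
  have "x \<noteq> 0" using assms(1) by auto
  have "isCont (ray_density x) t"
    using continuous_on_ray_density[OF \<open>x \<noteq> 0\<close>] assms(2) by (simp add: continuous_on_eq_continuous_at)
  then have "((\<lambda>u. integral {0..u} (ray_density x)) has_vector_derivative ray_density x t) (at t within ({0..t + 1} - {}))"
    using assms f_integrable[OF assms(1), of "t + 1"]
    by (intro integral_has_vector_derivative_continuous_at) (auto intro: continuous_at_imp_continuous_at_within)
  moreover have "at t within {0..t + 1} = at t"
    using assms(2) by (intro at_within_interior) simp
  ultimately show ?thesis
    by (simp add: has_real_derivative_iff_has_vector_derivative radial_integral_def[abs_def])
qed

lemma radial_integral_strict_mono:
  assumes "x \<in> sphere 0 1" "0 < a" "a < b"
  shows "radial_integral f x a < radial_integral f x b"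
proof (rule DERIV_pos_imp_increasing[OF assms(3)])
  fix t assume t: "a \<le> t" "t \<le> b"
  have "x \<noteq> 0" using assms(1) by auto
  then have "ray_density x t > 0" using t assms f_pos[of "t *\<^sub>R x"] by simp
  then show "\<exists>y. (radial_integral f x has_real_derivative y) (at t) \<and> y > 0"
    using radial_integral_derivative[OF assms(1), of t] t assms by auto
qed

text \<open>Substitution of \<open>a + u * (b - a)\<close>. The factor \<open>b - a\<close> comes
  out, the domain of integration becomes fixed, and both orders of \<open>a\<close> and
  \<open>b\<close> are covered at once.\<close>

lemma radial_integral_diff:
  assumes "x \<in> sphere 0 1" "a > 0" "b > 0"
  shows "radial_integral f x b - radial_integral f x a =
    (b - a) * integral {0..1} (\<lambda>u. ray_density x (a + u * (b - a)))"
proof -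
  have pos: "a + u * (b - a) > 0" if "u \<in> {0..1}" for u
  proof -
    have "a + u * (b - a) = (1 - u) * a + u * b" by (simp add: algebra_simps)
    also have "\<dots> > 0"
      using that assms(2,3) by (cases "u = 0") (auto intro: add_nonneg_pos)
    finally show ?thesis .
  qed
  have "((\<lambda>u. ray_density x (a + u * (b - a)) * (b - a)) has_integral
      radial_integral f x (a + 1 * (b - a)) - radial_integral f x (a + 0 * (b - a))) {0..1}"
  proof (rule fundamental_theorem_of_calculus)
    fix u :: real assume u: "u \<in> {0..1}"
    have "((\<lambda>u. a + u * (b - a)) has_real_derivative (b - a)) (at u)"
      by (auto intro!: derivative_eq_intros)
    with radial_integral_derivative[OF assms(1) pos[OF u]]
    have "((\<lambda>u. radial_integral f x (a + u * (b - a))) has_real_derivative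
        ray_density x (a + u * (b - a)) * (b - a)) (at u)"
      by (rule DERIV_chain2)
    then show "((\<lambda>u. radial_integral f x (a + u * (b - a))) has_vector_derivative
        ray_density x (a + u * (b - a)) * (b - a)) (at u within {0..1})"
      unfolding has_real_derivative_iff_has_vector_derivative
      by (rule has_vector_derivative_at_within)
  qed simp
  from integral_unique[OF this] show ?thesis by (simp add: mult.commute)
qed

text \<open>The substitution \<open>t = norm y * \<sigma> (u, y)\<close> writes the integral of the density along the ray of \<open>y\<close>
  from the boundary of \<open>L\<close> to \<open>y\<close> as \<open>norm y ^ (n - 1) * (1 - 1 / h y) * J y\<close>. The factor \<open>J\<close> is
  positive, and it is \<open>C\<^sup>2\<close> because it only involves \<open>f\<close> away from the origin.\<close>

definition \<sigma> :: "real \<times> (real ^ 'n) \<Rightarrow> real" where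
  "\<sigma> p = inverse (h (snd p)) + fst p * (1 - inverse (h (snd p)))"

definition J :: "real ^ 'n \<Rightarrow> real" where
  "J y = integral {0..1} (\<lambda>u. \<sigma> (u, y) ^ (CARD('n) - 2) * f (\<sigma> (u, y) *\<^sub>R y))"

text \<open>The term \<open>g (sgn y)\<close> of the defining equation divided by
  \<open>norm y ^ (CARD('n) - 1) * J y / h y\<close>, the positive factor that
  \<open>\<Psi>_eq\<close> extracts.\<close>

definition \<kappa> :: "real ^ 'n \<Rightarrow> real" where
  "\<kappa> y = h y * (g (y /\<^sub>R norm y) / norm y ^ (CARD('n) - 1)) / J y"

lemma \<sigma>_pos:
  assumes "y \<noteq> 0" "0 \<le> u" "u \<le> 1"
  shows "\<sigma> (u, y) > 0"
proof -
  have "\<sigma> (u, y) = (1 - u) * inverse (h y) + u" by (simp add: \<sigma>_def algebra_simps)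
  also have "\<dots> > 0"
    using h_pos[OF assms(1)] assms(2,3) by (cases "u = 0") (auto intro: add_nonneg_pos)
  finally show ?thesis .
qed

lemma C2_\<sigma>: "Ck_on 2 \<sigma> (UNIV \<times> - {0})"
proof -
  have "Ck_on 2 (\<lambda>p. inverse (h (snd p))) (UNIV \<times> - {0})"
    using h_pos
    by (intro Ck_on_inverse Ck_on_snd C2_h open_Times open_UNIV open_Compl_singleton) force+
  moreover have "Ck_on 2 fst (UNIV \<times> - {0 :: real ^ 'n})"
    by (intro Ck_on_bounded_linear bounded_linear_fst open_Times open_UNIV open_Compl_singleton)
  ultimately show ?thesis
    unfolding \<sigma>_def[abs_def]
    by (intro Ck_on_add Ck_on_mult Ck_on_diff Ck_on_const open_Times open_UNIV open_Compl_singleton)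
qed

lemma C2_J: "Ck_on 2 J (- {0})"
proof -
  let ?V = "UNIV \<times> - {0 :: real ^ 'n}"
  \<comment> \<open>Differentiating under the integral requires an open set around the strip, while
    positivity of \<open>\<sigma>\<close> is known only for parameters in [0,1].\<close>
  define U where "U = ?V \<inter> \<sigma> -` {0<..}"
  have "open ?V" by (intro open_Times open_UNIV open_Compl_singleton)
  then have "open U"
    unfolding U_def using Ck_on_imp_continuous_on[OF C2_\<sigma>]
    by (intro continuous_open_preimage open_greaterThan)
  have s: "Ck_on 2 \<sigma> U" by (rule Ck_on_subset[OF C2_\<sigma>]) (auto simp: U_def)
  have "Ck_on 2 (\<lambda>p. f (\<sigma> p *\<^sub>R snd p)) U"
  proof (rule Ck_on_compose[OF \<open>open U\<close> open_Compl_singleton _ C2_f])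
    show "(\<lambda>p. \<sigma> p *\<^sub>R snd p) ` U \<subseteq> - {0}" by (auto simp: U_def)
    fix i :: "real ^ 'n"
    have "bounded_linear (\<lambda>p :: real \<times> (real ^ 'n). snd p \<bullet> i)"
      by (rule bounded_linear_compose[OF bounded_linear_inner_left bounded_linear_snd])
    then have "Ck_on 2 (\<lambda>p. \<sigma> p * (snd p \<bullet> i)) U"
      by (intro Ck_on_mult \<open>open U\<close> s Ck_on_bounded_linear)
    then show "Ck_on 2 (\<lambda>p. (\<sigma> p *\<^sub>R snd p) \<bullet> i) U" by simp
  qed
  then have "Ck_on 2 (\<lambda>p. \<sigma> p ^ (CARD('n) - 2) * f (\<sigma> p *\<^sub>R snd p)) U"
    by (intro Ck_on_mult Ck_on_power \<open>open U\<close> s)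
  moreover have "{0..1} \<times> - {0} \<subseteq> U" using \<sigma>_pos by (auto simp: U_def)
  ultimately have "Ck_on 2 (\<lambda>y. integral {0..1}
      (\<lambda>u. \<sigma> (u, y) ^ (CARD('n) - 2) * f (\<sigma> (u, y) *\<^sub>R snd (u, y)))) (- {0})"
    using \<open>open U\<close> by (intro Ck_on_integral[of U] open_Compl_singleton)
  then show ?thesis by (simp add: J_def[abs_def])
qed

lemma J_pos:
  assumes "y \<noteq> 0"
  shows "J y > 0"
proof -
  let ?k = "\<lambda>u. \<sigma> (u, y) ^ (CARD('n) - 2) * f (\<sigma> (u, y) *\<^sub>R y)"
  have "continuous_on {0..1} (\<lambda>u. \<sigma> (u, y))"
    unfolding \<sigma>_def fst_conv snd_conv by (intro continuous_intros)
  then have "continuous_on {0..1} (\<lambda>u. ray_density y (\<sigma> (u, y)))"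
    by (rule continuous_on_compose2[OF continuous_on_ray_density[OF assms]]) (use \<sigma>_pos[OF assms] in auto)
  then have cont: "continuous_on {0..1} ?k" .
  then obtain u0 where u0: "u0 \<in> {0..1}" "\<And>u. u \<in> {0..1} \<Longrightarrow> ?k u0 \<le> ?k u"
    using continuous_attains_inf[of "{0..1::real}" ?k] by auto
  have "0 < ?k u0"
    using \<sigma>_pos[OF assms, of u0] u0(1) f_pos[of "\<sigma> (u0, y) *\<^sub>R y"] assms by simp
  also have "?k u0 = integral {0..1::real} (\<lambda>u. ?k u0)"
    unfolding integral_const_real by simp
  also have "\<dots> \<le> J y"
    unfolding J_def by (intro integral_le integrable_continuous_real cont u0(2)) auto
  finally show ?thesis .
qed

lemma C2_\<kappa>: "Ck_on 2 \<kappa> (- {0})"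
proof -
  have "Ck_on 2 (\<lambda>y. g (y /\<^sub>R norm y)) (- {0})"
  proof (rule Ck_on_compose[OF open_Compl_singleton open_Compl_singleton _ C2_g])
    fix i :: "real ^ 'n"
    have "Ck_on 2 (\<lambda>y :: real ^ 'n. (y \<bullet> i) / norm y) (- {0})"
      by (intro Ck_on_divide Ck_on_norm Ck_on_bounded_linear bounded_linear_inner_left open_Compl_singleton) auto
    then show "Ck_on 2 (\<lambda>y. (y /\<^sub>R norm y) \<bullet> i) (- {0})" by (simp add: field_simps)
  qed auto
  then show ?thesis
    unfolding \<kappa>_def[abs_def] using J_pos
    by (intro Ck_on_divide Ck_on_mult Ck_on_power Ck_on_norm C2_h C2_J open_Compl_singleton) force+
qed

text \<open>\<open>\<Omega> \<epsilon> y - 1\<close> has the same sign as the difference of the two sides of the equation defining the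
  perturbed body, so that body is \<open>{0} \<union> {y. \<Omega> \<epsilon> y \<le> 1}\<close>.\<close>

definition \<Omega> :: "real \<Rightarrow> real ^ 'n \<Rightarrow> real" where
  "\<Omega> \<epsilon> y = h y + \<epsilon> * \<kappa> y"

definition \<Psi> :: "real \<Rightarrow> real ^ 'n \<Rightarrow> real" where
  "\<Psi> \<epsilon> y = radial_integral f (sgn y) (norm y)
     - radial_integral f (sgn y) (radial_function L (sgn y)) + \<epsilon> * g (sgn y)"

lemma sgn_in_sphere: "y \<noteq> 0 \<Longrightarrow> sgn y \<in> sphere 0 1" for y :: "real ^ 'n"
  by (simp add: norm_sgn)

text \<open>The radius of L in the direction of \<open>y\<close> is \<open>norm y / h y\<close>, so
  \<open>radial_integral_diff\<close> applies between this radius and \<open>norm y\<close>. Scaling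
  the density gives the power \<open>CARD('n) - 2\<close> of the norm, and the length of the
  interval gives one more.\<close>

lemma \<Psi>_eq:
  assumes "y \<noteq> 0"
  shows "\<Psi> \<epsilon> y = norm y ^ (CARD('n) - 1) * J y / h y * (\<Omega> \<epsilon> y - 1)"
proof -
  define N where "N = norm y"
  have N: "N > 0" using assms by (simp add: N_def)
  have hy: "h y > 0" using h_pos[OF assms] .
  have y: "sgn y = y /\<^sub>R N" by (simp add: sgn_div_norm N_def)
  have "h (sgn y) = h y / N" using N by (simp add: y h_scaleR field_simps)
  moreover have "sgn y \<noteq> 0" using assms by (simp add: sgn_zero_iff)
  ultimately have "inverse (radial_function L (sgn y)) = h y / N"
    by (simp add: body_gauge_def[of L "sgn y"])
  then have "inverse (inverse (radial_function L (sgn y))) = inverse (h y / N)"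
    by (rule arg_cong)
  then have rad: "radial_function L (sgn y) = N * inverse (h y)"
    by (simp add: divide_inverse mult.commute)
  have dir: "(N * s) *\<^sub>R sgn y = s *\<^sub>R y" for s
    using N by (simp add: y field_simps)
  have card: "CARD('n) - 1 = Suc (CARD('n) - 2)" using dim_ge_2 by simp
  have a: "N * inverse (h y) + u * (N - N * inverse (h y)) = N * \<sigma> (u, y)" for u
    by (simp add: \<sigma>_def algebra_simps)
  have "radial_integral f (sgn y) N - radial_integral f (sgn y) (N * inverse (h y)) =
      (N - N * inverse (h y)) * integral {0..1} (\<lambda>u. ray_density (sgn y) (N * \<sigma> (u, y)))"
    using radial_integral_diff[OF sgn_in_sphere[OF assms], of "N * inverse (h y)" N] N hy by (simp add: a)
  also have "(\<lambda>u. ray_density (sgn y) (N * \<sigma> (u, y))) =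
      (\<lambda>u. N ^ (CARD('n) - 2) * (\<sigma> (u, y) ^ (CARD('n) - 2) * f (\<sigma> (u, y) *\<^sub>R y)))"
    by (simp only: dir power_mult_distrib mult.assoc)
  also have "integral {0..1} \<dots> = N ^ (CARD('n) - 2) * J y"
    by (simp add: J_def)
  finally have "radial_integral f (sgn y) N - radial_integral f (sgn y) (N * inverse (h y)) =
      N ^ (CARD('n) - 1) * (1 - inverse (h y)) * J y"
    unfolding card power_Suc by (simp add: algebra_simps)
  moreover define P where "P = N ^ (CARD('n) - 1)"
  ultimately have "\<Psi> \<epsilon> y = P * (1 - inverse (h y)) * J y + \<epsilon> * g (sgn y)"
    unfolding \<Psi>_def N_def[symmetric] rad by simp
  moreover have "\<Omega> \<epsilon> y = h y + \<epsilon> * (h y * (g (sgn y) / P) / J y)"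
    by (simp add: \<Omega>_def \<kappa>_def P_def y N_def)
  moreover have "P > 0" using N by (simp add: P_def)
  ultimately show ?thesis
    unfolding N_def[symmetric] P_def[symmetric]
    using hy J_pos[OF assms] by (simp add: field_simps)
qed

lemma \<Psi>_sign:
  assumes "y \<noteq> 0"
  shows "\<Psi> \<epsilon> y < 0 \<longleftrightarrow> \<Omega> \<epsilon> y < 1" "\<Psi> \<epsilon> y \<le> 0 \<longleftrightarrow> \<Omega> \<epsilon> y \<le> 1" "\<Psi> \<epsilon> y = 0 \<longleftrightarrow> \<Omega> \<epsilon> y = 1"
proof -
  define m where "m = norm y ^ (CARD('n) - 1) * J y / h y"
  have "m > 0" using assms J_pos[OF assms] h_pos[OF assms] by (simp add: m_def)
  moreover have "\<Psi> \<epsilon> y = m * (\<Omega> \<epsilon> y - 1)" using \<Psi>_eq[OF assms] by (simp add: m_def)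
  ultimately show "\<Psi> \<epsilon> y < 0 \<longleftrightarrow> \<Omega> \<epsilon> y < 1" "\<Psi> \<epsilon> y \<le> 0 \<longleftrightarrow> \<Omega> \<epsilon> y \<le> 1" "\<Psi> \<epsilon> y = 0 \<longleftrightarrow> \<Omega> \<epsilon> y = 1"
    by (auto simp: mult_less_0_iff mult_le_0_iff)
qed

lemma \<Psi>_strict_mono:
  assumes "y \<noteq> 0" "0 < s" "s < 1"
  shows "\<Psi> \<epsilon> (s *\<^sub>R y) < \<Psi> \<epsilon> y"
proof -
  have "sgn (s *\<^sub>R y) = sgn y" using assms(2) by (simp add: sgn_scaleR)
  moreover have "s * norm y < norm y" using assms by simp
  ultimately show ?thesis
    using radial_integral_strict_mono[OF sgn_in_sphere[OF assms(1)], of "s * norm y" "norm y"] assms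
    by (simp add: \<Psi>_def)
qed

lemma continuous_on_\<Omega>: "continuous_on (- {0}) (\<Omega> \<epsilon>)"
  unfolding \<Omega>_def[abs_def]
  by (intro continuous_intros continuous_on_h Ck_on_imp_continuous_on[OF C2_\<kappa>])

section \<open>Uniform estimates near the boundary of L\<close>

text \<open>A compact neighbourhood of the boundary of L that avoids the origin. A perturbation of
  size below 1/2 keeps \<open>\<Omega>\<close> below 1 where \<open>h\<close> is 1/2 and above 1
  where \<open>h\<close> is 2.\<close>

definition shell :: "(real ^ 'n) set" where
  "shell = {y. 1 / 2 \<le> h y \<and> h y \<le> 2}"

lemma shell_nonzero: "y \<in> shell \<Longrightarrow> y \<noteq> 0"
  by (auto simp: shell_def)

lemma compact_sublevel: "compact {y. h y \<le> c}"
proof -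
  define m where "m = max c 1"
  have "{y. h y \<le> c} \<subseteq> (\<lambda>x. m *\<^sub>R x) ` L"
  proof
    fix y assume "y \<in> {y. h y \<le> c}"
    then have "y /\<^sub>R m \<in> L" by (auto simp: scaleR_mem_iff m_def field_simps max_def)
    then show "y \<in> (\<lambda>x. m *\<^sub>R x) ` L" by (intro image_eqI[of _ _ "y /\<^sub>R m"]) (auto simp: m_def)
  qed
  then have "bounded {y. h y \<le> c}"
    using bounded_subset bounded_scaling[OF compact_imp_bounded[OF compact]] by blast
  moreover have "closed {y. h y \<le> c}"
    by (intro closed_Collect_le continuous_on_h continuous_on_const)
  ultimately show ?thesis by (simp add: compact_eq_bounded_closed)
qed

lemma compact_shell: "compact shell"
proof -
  have "shell = {y. h y \<le> 2} \<inter> {y. 1 / 2 \<le> h y}" by (auto simp: shell_def)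
  moreover have "compact ({y. h y \<le> 2} \<inter> {y. 1 / 2 \<le> h y})"
    by (intro compact_Int_closed compact_sublevel closed_Collect_le continuous_on_h continuous_on_const)
  ultimately show ?thesis by metis
qed

text \<open>The squared perturbed gauge is the squared gauge plus \<epsilon> times
  \<open>2 * h y * \<kappa> y\<close> plus the square of \<epsilon> times
  \<open>\<kappa> y ^ 2\<close>. Each of these functions is independent of \<epsilon>, so
  compactness bounds their Hessians once and for all.\<close>

lemma uniform_bounds:
  obtains c C where "c > 0" "C > 0"
    and "\<And>y v. y \<in> shell \<Longrightarrow> norm v = 1 \<Longrightarrow> (frechet_derivative h (at y) v)\<^sup>2 + h y * dir_deriv2 h y v v \<ge> c"
    and "\<And>y. y \<in> shell \<Longrightarrow> \<bar>\<kappa> y\<bar> \<le> C"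
    and "\<And>y v. y \<in> shell \<Longrightarrow> norm v = 1 \<Longrightarrow> \<bar>dir_deriv2 (\<lambda>y. 2 * h y * \<kappa> y) y v v\<bar> \<le> C"
    and "\<And>y v. y \<in> shell \<Longrightarrow> norm v = 1 \<Longrightarrow> \<bar>dir_deriv2 (\<lambda>y. \<kappa> y ^ 2) y v v\<bar> \<le> C"
proof -
  define X where "X = shell \<times> (sphere 0 1 :: (real ^ 'n) set)"
  have cX: "compact X" unfolding X_def by (intro compact_Times compact_shell compact_sphere)
  have sub: "X \<subseteq> (- {0}) \<times> UNIV" using shell_nonzero by (auto simp: X_def)
  let ?E = "\<lambda>p. (frechet_derivative h (at (fst p)) (snd p))\<^sup>2 + h (fst p) * dir_deriv2 h (fst p) (snd p) (snd p)"
  have hX: "continuous_on X (\<lambda>p. h (fst p))"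
    by (rule continuous_on_compose2[OF continuous_on_h[of UNIV]]) (auto intro!: continuous_intros)
  have contE: "continuous_on X ?E"
    by (intro continuous_on_add continuous_on_mult continuous_on_power hX
        continuous_on_subset[OF continuous_on_dir_deriv[OF C2_h] sub]
        continuous_on_subset[OF continuous_on_dir_deriv2(1)[OF C2_h] sub])
  have posE: "?E p > 0" if "p \<in> X" for p
  proof -
    have "fst p \<noteq> 0" "snd p \<noteq> 0" using that shell_nonzero by (auto simp: X_def)
    then show ?thesis by (rule squared_gauge_hessian_pos)
  qed
  obtain c where c: "c > 0" "\<And>p. p \<in> X \<Longrightarrow> ?E p \<ge> c"
  proof (cases "X = {}")
    case True
    then show thesis using that[of 1] by simp
  next
    case False
    then obtain p where "p \<in> X" "\<And>q. q \<in> X \<Longrightarrow> ?E p \<le> ?E q"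
      using continuous_attains_inf[OF cX _ contE] by blast
    then show thesis using that[of "?E p"] posE by blast
  qed
  have bounded: "\<exists>B. \<forall>p\<in>S. \<bar>F p\<bar> \<le> B" if "compact S" "continuous_on S F" for S and F :: "'c::topological_space \<Rightarrow> real"
    using compact_imp_bounded[OF compact_continuous_image[OF that(2,1)]] by (auto simp: bounded_iff)
  have k1: "Ck_on 2 (\<lambda>y. 2 * h y * \<kappa> y) (- {0})"
    by (intro Ck_on_mult Ck_on_const C2_h C2_\<kappa> open_Compl_singleton)
  have k2: "Ck_on 2 (\<lambda>y. \<kappa> y ^ 2) (- {0})"
    by (intro Ck_on_power C2_\<kappa> open_Compl_singleton)
  have "continuous_on shell \<kappa>"
    by (rule continuous_on_subset[OF Ck_on_imp_continuous_on[OF C2_\<kappa>]]) (use shell_nonzero in auto)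
  then obtain B0 where B0: "\<And>y. y \<in> shell \<Longrightarrow> \<bar>\<kappa> y\<bar> \<le> B0"
    using bounded[OF compact_shell] by blast
  obtain B1 where B1: "\<And>p. p \<in> X \<Longrightarrow> \<bar>dir_deriv2 (\<lambda>y. 2 * h y * \<kappa> y) (fst p) (snd p) (snd p)\<bar> \<le> B1"
    using bounded[OF cX continuous_on_subset[OF continuous_on_dir_deriv2(1)[OF k1] sub]] by blast
  obtain B2 where B2: "\<And>p. p \<in> X \<Longrightarrow> \<bar>dir_deriv2 (\<lambda>y. \<kappa> y ^ 2) (fst p) (snd p) (snd p)\<bar> \<le> B2"
    using bounded[OF cX continuous_on_subset[OF continuous_on_dir_deriv2(1)[OF k2] sub]] by blast
  show thesis
  proof (rule that[of c "max 1 (max B0 (max B1 B2))"])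
    fix y v :: "real ^ 'n" assume y: "y \<in> shell"
    show "\<bar>\<kappa> y\<bar> \<le> max 1 (max B0 (max B1 B2))" using B0[OF y] by simp
    assume "norm v = 1"
    then have X: "(y, v) \<in> X" using y by (simp add: X_def)
    show "(frechet_derivative h (at y) v)\<^sup>2 + h y * dir_deriv2 h y v v \<ge> c" using c(2)[OF X] by simp
    show "\<bar>dir_deriv2 (\<lambda>y. 2 * h y * \<kappa> y) y v v\<bar> \<le> max 1 (max B0 (max B1 B2))" using B1[OF X] by simp
    show "\<bar>dir_deriv2 (\<lambda>y. \<kappa> y ^ 2) y v v\<bar> \<le> max 1 (max B0 (max B1 B2))" using B2[OF X] by simp
  qed (use c(1) in auto)
qed

text \<open>Otherwise the square of \<open>\<Omega> \<epsilon>\<close> along the line would have a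
  local maximum at 0, although its second derivative there is at least
  \<open>2 * c - 2 * \<epsilon> * C\<close>.\<close>

lemma \<Omega>_no_local_max_on_unit_line:
  assumes "0 < \<epsilon>" and y: "y \<in> shell" and "\<Omega> \<epsilon> y = 1" and "norm v = 1" and "d > 0"
    and pos: "(frechet_derivative h (at y) v)\<^sup>2 + h y * dir_deriv2 h y v v \<ge> c"
    and bounds: "\<bar>dir_deriv2 (\<lambda>y. 2 * h y * \<kappa> y) y v v\<bar> \<le> C" "\<bar>dir_deriv2 (\<lambda>y. \<kappa> y ^ 2) y v v\<bar> \<le> C"
    and "\<epsilon> < 1" "\<epsilon> * C < c"
  shows "\<exists>s. \<bar>s\<bar> < d \<and> y + s *\<^sub>R v \<noteq> 0 \<and> \<Omega> \<epsilon> (y + s *\<^sub>R v) > 1"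
proof (rule ccontr)
  assume neg: "\<not> ?thesis"
  have y0: "y \<noteq> 0" using shell_nonzero[OF y] .
  let ?l = "\<lambda>s. y + s *\<^sub>R v"
  \<comment> \<open>Near \<open>y\<close> the line avoids the origin and \<open>\<Omega>\<close>
    stays positive; without a lower bound, \<open>\<Omega>\<close> being at most 1 would not bound
    its square.\<close>
  have "open ((- {0}) \<inter> \<Omega> \<epsilon> -` {0<..})"
    using continuous_on_\<Omega> by (intro continuous_open_preimage open_Compl_singleton open_greaterThan)
  then have "open (?l -` ((- {0}) \<inter> \<Omega> \<epsilon> -` {0<..}))"
    by (rule open_vimage) (intro continuous_intros)
  moreover define T where "T = ?l -` ((- {0}) \<inter> \<Omega> \<epsilon> -` {0<..})"
  moreover have "0 \<in> T" using y0 assms(3) by (simp add: T_def)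
  ultimately obtain r where r: "r > 0" "ball 0 r \<subseteq> T"
    using openE[of T 0] by metis
  then have r': "?l s \<noteq> 0" "\<Omega> \<epsilon> (?l s) > 0" if "\<bar>s\<bar> < r" for s
    using that by (auto simp: subset_iff dist_norm T_def)
  define k1 k2 where "k1 = (\<lambda>y. 2 * h y * \<kappa> y)" and "k2 = (\<lambda>y. \<kappa> y ^ 2)"
  have k1: "Ck_on 2 k1 (- {0})" unfolding k1_def
    by (intro Ck_on_mult Ck_on_const C2_h C2_\<kappa> open_Compl_singleton)
  have k2: "Ck_on 2 k2 (- {0})" unfolding k2_def
    by (intro Ck_on_power C2_\<kappa> open_Compl_singleton)
  let ?D = "\<lambda>F s. frechet_derivative F (at (?l s)) v"
  let ?f = "\<lambda>s. h (?l s) * h (?l s) + \<epsilon> * k1 (?l s) + \<epsilon>\<^sup>2 * k2 (?l s)"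
  let ?f' = "\<lambda>s. ?D h s * h (?l s) + ?D h s * h (?l s) + \<epsilon> * ?D k1 s + \<epsilon>\<^sup>2 * ?D k2 s"
  have f_eq: "?f s = (\<Omega> \<epsilon> (?l s))\<^sup>2" for s
    by (simp add: \<Omega>_def k1_def k2_def power2_eq_square algebra_simps)
  have first: "((\<lambda>s. F (?l s)) has_real_derivative ?D F s) (at s)"
    if "Ck_on 2 F (- {0})" "\<bar>s\<bar> < r" for F s
    using that r'(1)[of s] by (intro has_real_derivative_along_line Ck_on_2D(1)) auto
  have second: "(?D F has_real_derivative dir_deriv2 F y v v) (at 0)" if "Ck_on 2 F (- {0})" for F
    using has_real_derivative_frechet_along_line[OF that open_Compl_singleton, of y 0 v v] y0 by simp
  define S where "S = (dir_deriv2 h y v v * h (?l 0) + ?D h 0 * ?D h 0) +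
      (dir_deriv2 h y v v * h (?l 0) + ?D h 0 * ?D h 0) +
      \<epsilon> * dir_deriv2 k1 y v v + \<epsilon>\<^sup>2 * dir_deriv2 k2 y v v"
  have "S \<le> 0"
  proof (rule second_derivative_le_0_at_local_max[of "min r d" ?f ?f'])
    show "min r d > 0" using r(1) assms(5) by simp
    show "(?f has_real_derivative ?f' s) (at s)" if "\<bar>s\<bar> < min r d" for s
    proof -
      have "((\<lambda>s. h (?l s) * h (?l s)) has_real_derivative ?D h s * h (?l s) + ?D h s * h (?l s)) (at s)"
        using that by (intro DERIV_mult first C2_h) auto
      then show ?thesis
        using that by (intro DERIV_add DERIV_cmult first k1 k2) auto
    qed
    have "((\<lambda>s. ?D h s * h (?l s)) has_real_derivative
        dir_deriv2 h y v v * h (?l 0) + ?D h 0 * ?D h 0) (at 0)"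
      using r(1) by (intro DERIV_mult second first C2_h) auto
    then show "(?f' has_real_derivative S) (at 0)"
      unfolding S_def by (intro DERIV_add DERIV_cmult second k1 k2)
    show "?f s \<le> ?f 0" if "\<bar>s\<bar> < min r d" for s
    proof -
      have "\<Omega> \<epsilon> (?l s) \<le> 1" "\<Omega> \<epsilon> (?l s) > 0"
        using neg r'[of s] that by (metis min_less_iff_conj not_less)+
      then have "(\<Omega> \<epsilon> (?l s))\<^sup>2 \<le> 1" by (simp add: power_le_one)
      moreover have "?f 0 = 1" unfolding f_eq using assms(3) by simp
      ultimately show ?thesis unfolding f_eq by simp
    qed
  qed
  moreover have "S > 0"
  proof -
    define Q X Y where "Q = (frechet_derivative h (at y) v)\<^sup>2 + h y * dir_deriv2 h y v v"
      and "X = \<epsilon> * dir_deriv2 k1 y v v" and "Y = \<epsilon>\<^sup>2 * dir_deriv2 k2 y v v"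
    have "S = 2 * Q + X + Y"
      by (simp add: S_def Q_def X_def Y_def power2_eq_square algebra_simps)
    moreover have "\<bar>X\<bar> \<le> \<epsilon> * C"
      using bounds(1) assms(1) by (simp add: X_def abs_mult k1_def)
    \<comment> \<open>As \<epsilon> is below 1, the quadratic term obeys the same bound as the
      linear one.\<close>
    moreover have "\<bar>Y\<bar> \<le> \<epsilon> * C"
    proof -
      have "\<epsilon>\<^sup>2 \<le> \<epsilon>" using assms(1,9) by (simp add: power2_eq_square mult_le_one)
      then have "\<epsilon>\<^sup>2 * \<bar>dir_deriv2 k2 y v v\<bar> \<le> \<epsilon> * C"
        using bounds(2) assms(1) by (intro mult_mono) (auto simp: k2_def)
      then show ?thesis by (simp add: Y_def abs_mult)
    qed
    moreover have "Q \<ge> c" using pos by (simp add: Q_def)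
    ultimately show ?thesis using assms(10) by linarith
  qed
  ultimately show False by simp
qed

lemma \<Omega>_no_local_max:
  assumes "0 < \<epsilon>" "y \<in> shell" "\<Omega> \<epsilon> y = 1" "v \<noteq> 0" "d > 0"
    and "\<And>v. norm v = 1 \<Longrightarrow> (frechet_derivative h (at y) v)\<^sup>2 + h y * dir_deriv2 h y v v \<ge> c"
    and "\<And>v. norm v = 1 \<Longrightarrow> \<bar>dir_deriv2 (\<lambda>y. 2 * h y * \<kappa> y) y v v\<bar> \<le> C"
    and "\<And>v. norm v = 1 \<Longrightarrow> \<bar>dir_deriv2 (\<lambda>y. \<kappa> y ^ 2) y v v\<bar> \<le> C"
    and "\<epsilon> < 1" "\<epsilon> * C < c"
  shows "\<exists>s. \<bar>s\<bar> < d \<and> y + s *\<^sub>R v \<noteq> 0 \<and> \<Omega> \<epsilon> (y + s *\<^sub>R v) > 1"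
proof -
  have n: "norm (sgn v) = 1" using assms(4) by (simp add: norm_sgn)
  have "d * norm v > 0" using assms(4,5) by simp
  then obtain s where s: "\<bar>s\<bar> < d * norm v" "y + s *\<^sub>R sgn v \<noteq> 0" "\<Omega> \<epsilon> (y + s *\<^sub>R sgn v) > 1"
    using \<Omega>_no_local_max_on_unit_line[OF assms(1-3) n _ assms(6)[OF n] assms(7)[OF n] assms(8)[OF n] assms(9,10)]
    by blast
  have "(s / norm v) *\<^sub>R v = s *\<^sub>R sgn v" by (simp add: sgn_div_norm divide_inverse)
  moreover have "\<bar>s / norm v\<bar> < d" using s(1) assms(4) by (simp add: field_simps)
  ultimately show ?thesis using s(2,3) by (intro exI[of _ "s / norm v"]) simp
qed

section \<open>Existence and uniqueness of the perturbed body\<close>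

definition perturbed_set :: "real \<Rightarrow> (real ^ 'n) set" where
  "perturbed_set \<epsilon> = {y. y = 0 \<or> \<Omega> \<epsilon> y \<le> 1}"

context
  fixes \<epsilon> C :: real
  assumes eps: "0 < \<epsilon>" "\<epsilon> * C < 1 / 2" and \<kappa>_bound: "\<And>y. y \<in> shell \<Longrightarrow> \<bar>\<kappa> y\<bar> \<le> C"
begin

lemma \<kappa>_small:
  assumes "y \<in> shell"
  shows "\<bar>\<epsilon> * \<kappa> y\<bar> < 1 / 2"
proof -
  have "\<bar>\<epsilon> * \<kappa> y\<bar> \<le> \<epsilon> * C"
    using \<kappa>_bound[OF assms] eps(1) by (simp add: abs_mult)
  then show ?thesis using eps(2) by linarith
qed

text \<open>\<open>\<kappa>\<close> is bounded only on the shell. The inequality holds where the ray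
  meets the level 1/2 of \<open>h\<close>, and monotonicity of \<open>\<Psi>\<close> carries it
  inwards.\<close>

lemma \<Omega>_less_1:
  assumes "y \<noteq> 0" "h y \<le> 1 / 2"
  shows "\<Omega> \<epsilon> y < 1"
proof -
  have hy: "h y > 0" using h_pos[OF assms(1)] .
  define x where "x = inverse (2 * h y) *\<^sub>R y"
  have x0: "x \<noteq> 0" using assms(1) hy by (simp add: x_def)
  have "h x = 1 / 2" using hy by (simp add: x_def h_scaleR)
  moreover from this have "x \<in> shell" by (simp add: shell_def)
  ultimately have "\<Omega> \<epsilon> x < 1" using \<kappa>_small[of x] by (simp add: \<Omega>_def)
  then have neg: "\<Psi> \<epsilon> x < 0" using \<Psi>_sign(1)[OF x0] by simp
  have y: "y = (2 * h y) *\<^sub>R x" using hy by (simp add: x_def)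
  show ?thesis
  proof (cases "2 * h y = 1")
    case True
    then show ?thesis using y \<open>\<Omega> \<epsilon> x < 1\<close> by simp
  next
    case False
    then have "\<Psi> \<epsilon> y < \<Psi> \<epsilon> x" using \<Psi>_strict_mono[OF x0, of "2 * h y"] assms(2) hy y by simp
    then have "\<Psi> \<epsilon> y < 0" using neg by linarith
    then show ?thesis using \<Psi>_sign(1)[OF assms(1)] by simp
  qed
qed

text \<open>The same transport along the ray, outwards from the level 2 of \<open>h\<close>.\<close>

lemma \<Omega>_greater_1:
  assumes "h y \<ge> 2"
  shows "\<Omega> \<epsilon> y > 1"
proof (rule ccontr)
  assume neg: "\<not> \<Omega> \<epsilon> y > 1"
  have y0: "y \<noteq> 0" using assms by auto
  define x where "x = (2 / h y) *\<^sub>R y"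
  have x0: "x \<noteq> 0" using y0 assms by (simp add: x_def)
  have "h x = 2" using assms by (simp add: x_def h_scaleR)
  moreover from this have "x \<in> shell" by (simp add: shell_def)
  ultimately have gt: "\<Omega> \<epsilon> x > 1" using \<kappa>_small[of x] by (simp add: \<Omega>_def)
  have "\<Psi> \<epsilon> y \<le> 0" using neg \<Psi>_sign(2)[OF y0] by simp
  moreover have "\<Psi> \<epsilon> x \<le> \<Psi> \<epsilon> y"
  proof (cases "h y = 2")
    case True
    then show ?thesis by (simp add: x_def)
  next
    case False
    then show ?thesis using \<Psi>_strict_mono[OF y0, of "2 / h y" \<epsilon>] assms by (simp add: x_def)
  qed
  ultimately show False using gt \<Psi>_sign(2)[OF x0, of \<epsilon>] by simp
qed

lemma interior_perturbed_set:
  assumes "y = 0 \<or> \<Omega> \<epsilon> y < 1"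
  shows "y \<in> interior (perturbed_set \<epsilon>)"
proof (cases "y = 0")
  case True
  have "open {y. h y < 1 / 2}"
    by (intro open_Collect_less continuous_on_h continuous_on_const)
  then have "{y. h y < 1 / 2} \<subseteq> interior (perturbed_set \<epsilon>)"
    using \<Omega>_less_1 by (intro interior_maximal) (force simp: perturbed_set_def)+
  then show ?thesis using True by auto
next
  case False
  have "open ((- {0}) \<inter> \<Omega> \<epsilon> -` {..<1})"
    using continuous_on_\<Omega> by (intro continuous_open_preimage open_Compl_singleton open_lessThan)
  then have "(- {0}) \<inter> \<Omega> \<epsilon> -` {..<1} \<subseteq> interior (perturbed_set \<epsilon>)"
    by (intro interior_maximal) (auto simp: perturbed_set_def)
  then show ?thesis using assms False by auto
qed

lemma scaleR_in_interior_perturbed_set: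
  assumes "x \<in> perturbed_set \<epsilon>" "0 \<le> s" "s < 1"
  shows "s *\<^sub>R x \<in> interior (perturbed_set \<epsilon>)"
proof (cases "x = 0 \<or> s = 0")
  case True
  then show ?thesis using interior_perturbed_set[of 0] by auto
next
  case False
  then have "x \<noteq> 0" "s > 0" "s *\<^sub>R x \<noteq> 0" using assms by auto
  moreover have "\<Psi> \<epsilon> x \<le> 0" using assms(1) \<open>x \<noteq> 0\<close> \<Psi>_sign(2) by (simp add: perturbed_set_def)
  ultimately have "\<Omega> \<epsilon> (s *\<^sub>R x) < 1"
    using \<Psi>_strict_mono[of x s \<epsilon>] assms(3) \<Psi>_sign(1)[of "s *\<^sub>R x" \<epsilon>] by simp
  then show ?thesis by (intro interior_perturbed_set) simp
qed

lemma compact_perturbed_set: "compact (perturbed_set \<epsilon>)"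
proof -
  have "open ((- {0}) \<inter> \<Omega> \<epsilon> -` {1<..})"
    using continuous_on_\<Omega> by (intro continuous_open_preimage open_Compl_singleton open_greaterThan)
  moreover have "- perturbed_set \<epsilon> = (- {0}) \<inter> \<Omega> \<epsilon> -` {1<..}" by (auto simp: perturbed_set_def)
  ultimately have "closed (perturbed_set \<epsilon>)" by (simp add: closed_def)
  moreover have "perturbed_set \<epsilon> \<subseteq> {y. h y \<le> 2}"
  proof
    fix y assume "y \<in> perturbed_set \<epsilon>"
    then show "y \<in> {y. h y \<le> 2}"
      using \<Omega>_greater_1[of y] by (cases "h y \<le> 2") (auto simp: perturbed_set_def)
  qed
  ultimately show ?thesis
    using compact_sublevel[of 2] by (metis compact_Int_closed inf.absorb_iff2)
qed

lemma star_body_perturbed_set: "star_body (perturbed_set \<epsilon>)"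
  unfolding star_body_def
proof (intro conjI ballI subsetI)
  show "compact (perturbed_set \<epsilon>)" by (rule compact_perturbed_set)
  show "0 \<in> interior (perturbed_set \<epsilon>)" by (rule interior_perturbed_set) simp
  fix x y assume x: "x \<in> perturbed_set \<epsilon>" and "y \<in> closed_segment 0 x"
  then obtain u where u: "0 \<le> u" "u \<le> 1" "y = u *\<^sub>R x" by (auto simp: in_segment)
  then show "y \<in> perturbed_set \<epsilon>"
    using x scaleR_in_interior_perturbed_set[OF x, of u] interior_subset by (cases "u = 1") auto
qed

lemma perturbed_body_exists: "perturbed_body L f g \<epsilon> (perturbed_set \<epsilon>)"
  unfolding perturbed_body_def
proof (intro conjI ballI)
  show "star_body (perturbed_set \<epsilon>)" by (rule star_body_perturbed_set)
  fix x :: "real ^ 'n" assume x: "x \<in> sphere 0 1"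
  then have x0: "x \<noteq> 0" and nx: "norm x = 1" by auto
  define R where "R = radial_function (perturbed_set \<epsilon>) x"
  have R: "R > 0" "\<And>t. t \<ge> 0 \<Longrightarrow> t *\<^sub>R x \<in> perturbed_set \<epsilon> \<longleftrightarrow> t \<le> R"
    using star_body_radial_function[OF star_body_perturbed_set x0] by (auto simp: R_def)
  have Rx: "R *\<^sub>R x \<noteq> 0" "R *\<^sub>R x \<in> perturbed_set \<epsilon>" using R x0 by auto
  \<comment> \<open>A value below 1 would make the endpoint interior, and the ray could be continued
    inside the set beyond R.\<close>
  have "\<Omega> \<epsilon> (R *\<^sub>R x) = 1"
  proof (rule ccontr)
    assume "\<Omega> \<epsilon> (R *\<^sub>R x) \<noteq> 1"
    then have "R *\<^sub>R x \<in> interior (perturbed_set \<epsilon>)"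
      using Rx by (intro interior_perturbed_set) (auto simp: perturbed_set_def)
    then obtain e where e: "e > 0" "cball (R *\<^sub>R x) e \<subseteq> perturbed_set \<epsilon>" using mem_interior_cball by blast
    have "dist (R *\<^sub>R x) ((R + e) *\<^sub>R x) = e"
      using e(1) nx by (simp add: dist_norm algebra_simps)
    then have "(R + e) *\<^sub>R x \<in> perturbed_set \<epsilon>" using e(2) by (auto simp: subset_iff)
    then show False using R(2)[of "R + e"] R(1) e(1) by simp
  qed
  then have "\<Psi> \<epsilon> (R *\<^sub>R x) = 0" using \<Psi>_sign(3)[OF Rx(1)] by simp
  moreover have "sgn (R *\<^sub>R x) = x" "norm (R *\<^sub>R x) = R"
    using R(1) nx by (auto simp: sgn_div_norm)
  ultimately show "radial_integral f x (radial_function (perturbed_set \<epsilon>) x) =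
      radial_integral f x (radial_function L x) - \<epsilon> * g x"
    by (simp add: \<Psi>_def R_def)
qed

text \<open>Strict monotonicity of the radial integral determines the radius in each direction, and
  the radial function determines a star body.\<close>

lemma perturbed_body_unique:
  assumes "perturbed_body L f g \<epsilon> K"
  shows "K = perturbed_set \<epsilon>"
proof -
  have star: "star_body K" using assms by (simp add: perturbed_body_def)
  have "radial_function K x = radial_function (perturbed_set \<epsilon>) x" if x: "x \<in> sphere 0 1" for x
  proof -
    have "x \<noteq> 0" using x by auto
    then have "radial_function K x > 0" "radial_function (perturbed_set \<epsilon>) x > 0"
      using star_body_radial_function(1) star star_body_perturbed_set by auto
    moreover have "radial_integral f x (radial_function K x) = radial_integral f x (radial_function (perturbed_set \<epsilon>) x)"
      using assms perturbed_body_exists x by (simp add: perturbed_body_def)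
    ultimately show ?thesis
      using radial_integral_strict_mono[OF x] by (metis less_irrefl linorder_less_linear)
  qed
  then show ?thesis
    using star_body_mem_iff[OF star] star_body_mem_iff[OF star_body_perturbed_set] sgn_in_sphere by (metis subsetI subset_antisym)
qed

end

section \<open>Choice of the threshold and convexity\<close>

lemma perturbed_bodies_convex:
  "\<exists>\<epsilon>0>0. \<forall>\<epsilon>. 0 < \<epsilon> \<and> \<epsilon> < \<epsilon>0 \<longrightarrow>
     (\<exists>!K. perturbed_body L f g \<epsilon> K) \<and> (\<forall>K. perturbed_body L f g \<epsilon> K \<longrightarrow> convex K)"
proof -
  obtain c C where c: "c > 0" and C: "C > 0"
    and pos: "\<And>y v. y \<in> shell \<Longrightarrow> norm v = 1 \<Longrightarrow> (frechet_derivative h (at y) v)\<^sup>2 + h y * dir_deriv2 h y v v \<ge> c"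
    and \<kappa>: "\<And>y. y \<in> shell \<Longrightarrow> \<bar>\<kappa> y\<bar> \<le> C"
    and k1: "\<And>y v. y \<in> shell \<Longrightarrow> norm v = 1 \<Longrightarrow> \<bar>dir_deriv2 (\<lambda>y. 2 * h y * \<kappa> y) y v v\<bar> \<le> C"
    and k2: "\<And>y v. y \<in> shell \<Longrightarrow> norm v = 1 \<Longrightarrow> \<bar>dir_deriv2 (\<lambda>y. \<kappa> y ^ 2) y v v\<bar> \<le> C"
    by (rule uniform_bounds) blast
  \<comment> \<open>The bound 1 makes the quadratic term no larger than the linear one, the bound
    \<open>(1 / 2) / C\<close> confines the frontier of the new body to the shell, and
    \<open>c / C\<close> keeps the Hessian positive definite.\<close>
  define \<epsilon>0 where "\<epsilon>0 = min 1 (min (1 / 2) c / C)"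
  show ?thesis
  proof (intro exI[of _ \<epsilon>0] conjI allI impI)
    show "\<epsilon>0 > 0" using c C by (simp add: \<epsilon>0_def)
    fix \<epsilon> assume "0 < \<epsilon> \<and> \<epsilon> < \<epsilon>0"
    then have eps: "0 < \<epsilon>" "\<epsilon> < 1" "\<epsilon> < min (1 / 2) c / C" by (auto simp: \<epsilon>0_def)
    have "\<epsilon> * C < min (1 / 2) c" using eps(3) C by (simp add: pos_less_divide_eq)
    then have eC: "\<epsilon> * C < 1 / 2" "\<epsilon> * C < c" by auto
    have ex: "perturbed_body L f g \<epsilon> (perturbed_set \<epsilon>)"
      using perturbed_body_exists[OF eps(1) eC(1)] \<kappa> by blast
    have uniq: "K = perturbed_set \<epsilon>" if "perturbed_body L f g \<epsilon> K" for K
      using perturbed_body_unique[OF eps(1) eC(1)] \<kappa> that by blast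
    show "\<exists>!K. perturbed_body L f g \<epsilon> K" using ex uniq by blast
    have "convex (perturbed_set \<epsilon>)"
    proof (rule convex_if_no_segment_touches_frontier)
      show "closed (perturbed_set \<epsilon>)" using compact_perturbed_set[OF eps(1) eC(1)] \<kappa> compact_imp_closed by blast
      show "0 \<in> interior (perturbed_set \<epsilon>)" using interior_perturbed_set[OF eps(1) eC(1)] \<kappa> by blast
      show "s *\<^sub>R x \<in> interior (perturbed_set \<epsilon>)" if "x \<in> perturbed_set \<epsilon>" "0 \<le> s" "s < 1" for x s
        using scaleR_in_interior_perturbed_set[OF eps(1) eC(1)] \<kappa> that by blast
      fix p v :: "real ^ 'n" and d :: real
      assume p: "p \<in> perturbed_set \<epsilon>" "p \<notin> interior (perturbed_set \<epsilon>)" and v: "v \<noteq> 0" "d > 0"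
      have "\<not> (p = 0 \<or> \<Omega> \<epsilon> p < 1)" using interior_perturbed_set[OF eps(1) eC(1)] \<kappa> p(2) by blast
      then have p0: "p \<noteq> 0" and om: "\<Omega> \<epsilon> p = 1" using p(1) by (auto simp: perturbed_set_def)
      have "\<not> h p \<le> 1 / 2"
        using \<Omega>_less_1[OF eps(1) eC(1) _ p0] \<kappa> om by (metis less_irrefl)
      moreover have "\<not> h p \<ge> 2"
        using \<Omega>_greater_1[OF eps(1) eC(1)] \<kappa> om by (metis less_irrefl)
      ultimately have "p \<in> shell" by (simp add: shell_def)
      then obtain s where "\<bar>s\<bar> < d" "p + s *\<^sub>R v \<noteq> 0" "\<Omega> \<epsilon> (p + s *\<^sub>R v) > 1"
        using \<Omega>_no_local_max[OF eps(1) _ om v pos k1 k2 eps(2) eC(2)] by blast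
      then show "\<exists>s. \<bar>s\<bar> < d \<and> p + s *\<^sub>R v \<notin> perturbed_set \<epsilon>" by (auto simp: perturbed_set_def)
    qed
    then show "convex K" if "perturbed_body L f g \<epsilon> K" for K
      using uniq[OF that] by simp
  qed
qed

end

text \<open>The origin is the midpoint of an interior point and its reflection, and the interior is
  convex.\<close>

lemma zero_in_interior_symmetric_convex_body:
  assumes "convex_body L" "origin_symmetric L"
  shows "0 \<in> interior L"
proof -
  obtain p where p: "p \<in> interior L" using assms(1) by (auto simp: convex_body_def)
  have "uminus ` L = L" using assms(2) by (force simp: origin_symmetric_def image_iff)
  then have "- p \<in> interior L" using p interior_negations[of L] by auto
  then have "(1 / 2) *\<^sub>R p + (1 / 2) *\<^sub>R (- p) \<in> interior L"
    using p assms(1) by (intro convexD convex_interior) (auto simp: convex_body_def)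
  then show ?thesis by simp
qed

text \<open>Existence and uniqueness belong to the conclusion: they make D well defined and keep the
  convexity claim from being vacuous.\<close>

theorem proposition2:
  fixes L :: "(real ^ 'n) set" and f g :: "real ^ 'n \<Rightarrow> real"
  assumes "CARD('n) \<ge> 2"
    and "convex_body L" and "origin_symmetric L" and "smooth_positive_curvature L"
    and "Ck_on 2 f (- {0})" and "Ck_on 2 g (- {0})"
    and "even_off_origin f" and "even_off_origin g"
    and "\<And>x. x \<noteq> 0 \<Longrightarrow> f x > 0"
    and "\<And>x R. x \<in> sphere 0 1 \<Longrightarrow> R > 0 \<Longrightarrow>
           (\<lambda>t. t ^ (CARD('n) - 2) * f (t *\<^sub>R x)) integrable_on {0..R}"
  shows "\<exists>\<epsilon>0>0. \<forall>\<epsilon>. 0 < \<epsilon> \<and> \<epsilon> < \<epsilon>0 \<longrightarrow>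
           (\<exists>!D. perturbed_body L f g \<epsilon> D) \<and>
           (\<forall>D. perturbed_body L f g \<epsilon> D \<longrightarrow> convex D)"
proof -
  interpret gauge_perturbation L f g
  proof unfold_locales
    show "compact L" "convex L" using assms(2) by (simp_all add: convex_body_def)
    show "0 \<in> interior L" by (rule zero_in_interior_symmetric_convex_body[OF assms(2,3)])
    show "smooth_hypersurface (frontier L)"
      and "\<And>p. p \<in> frontier L \<Longrightarrow> \<exists>\<kappa>>0. has_gaussian_curvature L p \<kappa>"
      using assms(4) by (simp_all add: smooth_positive_curvature_def)
  qed (fact assms)+
  show ?thesis by (rule perturbed_bodies_convex)
qed

end
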